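(* Let $R=K[x_1,\dots,x_n]$ be a polynomial ring in $n$ variables over a field $K$ and let $I\subset R$ be a (nonzero, proper) symmetric shifted ideal all of whose minimal monomial generators have the same degree. Then $\mathrm{depth}(R/I^k)\ge\mathrm{depth}(R/I^{k+1})$ for all $k\ge1$. Moreover: (1) if $I=\mathrm{Sss}(\{(a,\dots,a)\})=(x_1^a\cdots x_n^a)$ for some $a\in\mathbb N$, then $\mathrm{depth}(R/I^k)=n-1$ for all $k\ge1$, and $\mathrm{dstab}(I)=1$; (2) otherwise, $\mathrm{depth}(R/I^k)\le n-k-1$ for $1\le k\le n-1$ and $\mathrm{depth}(R/I^k)=0$ for $k\ge n-1$; in particular, $\mathrm{dstab}(I)\le n-1$ and $\mathfrak m=(x_1,\dots,x_n)\in\mathrm{Ass}(I^k)$ for every $k\ge n-1$.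
   Context: $\mathfrak S_n$ acts on $R$ by permuting variables. $P_n=\{\lambda\in\mathbb Z^n: 0\le\lambda_1\le\cdots\le\lambda_n\}$, $x^\lambda=x_1^{\lambda_1}\cdots x_n^{\lambda_n}$. For an $\mathfrak S_n$-fixed monomial ideal $I$ put $P(I)=\{\lambda\in P_n: x^\lambda\in I\}$. An $\mathfrak S_n$-fixed monomial ideal $I$ is symmetric shifted if for every $\lambda\in P(I)$ and $1\le i<n$ with $\lambda_i<\lambda_n$ one has $x^\lambda x_i/x_n\in I$. It is symmetric strongly shifted if for every $\lambda\in P(I)$ and $1\le i<j\le n$ with $\lambda_i<\lambda_j$ one has $x^\lambda x_i/x_j\in I$. For $B\subseteq P_n$, $\mathrm{Sss}(B)$ is the smallest symmetric strongly shifted ideal containing $\{x^\lambda:\lambda\in B\}$. $\mathrm{dstab}(I)$ is the smallest $k_0\ge1$ such that $\mathrm{depth}(R/I^k)=\mathrm{depth}(R/I^{k_0})$ for all $k\ge k_0$. *)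

theory Defs
  imports
    "HOL-Library.Poly_Mapping"
    "HOL-Library.Extended_Nat"
    "HOL-Library.Cardinality"
    "HOL-Algebra.Ideal_Product"
    "HOL-Algebra.Algebraic_Closure_Type"
begin

text \<open>The polynomial ring \<open>K[x\<^sub>1,\<dots>,x\<^sub>n]\<close> is the type of finitely supported maps from exponent
  vectors to \<open>K\<close>. The variables are indexed by a finite linearly ordered type \<open>'n\<close> with
  \<open>n = CARD('n)\<close>; the index \<open>n\<close> of the last variable is \<open>Max UNIV\<close>.\<close>

type_synonym 'n expo = "'n \<Rightarrow>\<^sub>0 nat"
type_synonym ('n, 'k) mpoly = "'n expo \<Rightarrow>\<^sub>0 'k"

abbreviation polyring :: "('n, 'k::field) mpoly ring"
  where "polyring \<equiv> ring_of_type_algebra"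

definition xpow :: "'n expo \<Rightarrow> ('n, 'k::field) mpoly"
  where "xpow l = Poly_Mapping.single l 1"

definition var :: "'n \<Rightarrow> ('n, 'k::field) mpoly"
  where "var i = xpow (Poly_Mapping.single i 1)"

definition expo_degree :: "'n::finite expo \<Rightarrow> nat"
  where "expo_degree l = (\<Sum>i\<in>UNIV. Poly_Mapping.lookup l i)"

definition const_expo :: "nat \<Rightarrow> 'n::finite expo"
  where "const_expo a = (\<Sum>i\<in>UNIV. Poly_Mapping.single i a)"

text \<open>For bijective \<open>s\<close>, the coefficient of \<open>perm_act s p\<close> at \<open>m\<close> is that of \<open>p\<close> at \<open>m \<circ> s\<close>,
  so \<open>perm_act s\<close> is the \<open>K\<close>-algebra automorphism sending \<open>var i\<close> to \<open>var (s i)\<close>.\<close>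

definition perm_act :: "('n \<Rightarrow> 'n) \<Rightarrow> ('n, 'k::field) mpoly \<Rightarrow> ('n, 'k) mpoly"
  where "perm_act s = Poly_Mapping.map_key (Poly_Mapping.map_key s)"

lemma perm_act_var:
  assumes "bij s"
  shows "perm_act s (var i :: ('n, 'k::field) mpoly) = var (s i)"
proof -
  have s: "inj s" "surj s" using assms by (auto simp: bij_def)
  have "inj (Poly_Mapping.map_key s :: 'n expo \<Rightarrow> 'n expo)"
  proof (rule injI)
    fix l m :: "'n expo"
    assume "Poly_Mapping.map_key s l = Poly_Mapping.map_key s m"
    then have "Poly_Mapping.lookup l (s j) = Poly_Mapping.lookup m (s j)" for j
      using map_key.rep_eq[OF s(1)] by (metis comp_apply)
    then show "l = m" using s(2) by (metis poly_mapping_eqI surjD)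
  qed
  moreover have "Poly_Mapping.map_key s (Poly_Mapping.single (s i) 1) =
      (Poly_Mapping.single i 1 :: 'n expo)"
    using s(1) by simp
  ultimately show ?thesis
    unfolding perm_act_def var_def xpow_def by (metis map_key_single)
qed

definition monomial_ideal :: "('n, 'k::field) mpoly set \<Rightarrow> bool"
  where "monomial_ideal I \<longleftrightarrow> (\<exists>M. I = Idl\<^bsub>polyring\<^esub> (xpow ` M))"

definition sym_monomial_ideal :: "('n, 'k::field) mpoly set \<Rightarrow> bool"
  where "sym_monomial_ideal I \<longleftrightarrow> monomial_ideal I \<and> (\<forall>s. bij s \<longrightarrow> perm_act s ` I = I)"

text \<open>Exponents of the minimal monomial generators of a monomial ideal.\<close>

definition min_gens :: "('n, 'k::field) mpoly set \<Rightarrow> 'n expo set"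
  where "min_gens I = {l. (xpow l :: ('n, 'k) mpoly) \<in> I \<and>
    (\<forall>m. (xpow m :: ('n, 'k) mpoly) \<in> I \<and> (xpow m :: ('n, 'k) mpoly) dvd xpow l \<longrightarrow> m = l)}"

definition Pn :: "'n::linorder expo set"
  where "Pn = {l. mono (Poly_Mapping.lookup l)}"

definition P_of :: "('n::linorder, 'k::field) mpoly set \<Rightarrow> 'n expo set"
  where "P_of I = {l \<in> Pn. xpow l \<in> I}"

text \<open>The exponent of \<open>x\<^sup>l x\<^sub>i / x\<^sub>j\<close>; it is only used when \<open>j\<close> occurs in \<open>l\<close>.\<close>

definition exch :: "'n expo \<Rightarrow> 'n \<Rightarrow> 'n \<Rightarrow> 'n expo"
  where "exch l i j = l + Poly_Mapping.single i 1 - Poly_Mapping.single j 1"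

definition sym_shifted :: "('n::{finite,linorder}, 'k::field) mpoly set \<Rightarrow> bool"
  where "sym_shifted I \<longleftrightarrow> sym_monomial_ideal I \<and>
    (\<forall>l\<in>P_of I. \<forall>i < Max UNIV. Poly_Mapping.lookup l i < Poly_Mapping.lookup l (Max UNIV) \<longrightarrow>
       xpow (exch l i (Max UNIV)) \<in> I)"

definition sym_strongly_shifted :: "('n::{finite,linorder}, 'k::field) mpoly set \<Rightarrow> bool"
  where "sym_strongly_shifted I \<longleftrightarrow> sym_monomial_ideal I \<and>
    (\<forall>l\<in>P_of I. \<forall>i j. i < j \<and> Poly_Mapping.lookup l i < Poly_Mapping.lookup l j \<longrightarrow>
       xpow (exch l i j) \<in> I)"

definition Sss :: "'n::{finite,linorder} expo set \<Rightarrow> ('n, 'k::field) mpoly set"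
  where "Sss B = \<Inter>{J. sym_strongly_shifted J \<and> xpow ` B \<subseteq> J}"

definition max_ideal :: "('n, 'k::field) mpoly set"
  where "max_ideal = Idl\<^bsub>polyring\<^esub> (range var)"

abbreviation ideal_power :: "('n, 'k::field) mpoly set \<Rightarrow> nat \<Rightarrow> ('n, 'k) mpoly set"
  where "ideal_power I k \<equiv> I [^]\<^bsub>ideals_set polyring\<^esub> k"

text \<open>\<open>f\<^sub>1,\<dots>,f\<^sub>r\<close> is a regular sequence on \<open>R/I\<close>: each \<open>f\<^sub>i\<close> is a nonzerodivisor on
  \<open>R/(I + (f\<^sub>1,\<dots>,f\<^sub>i\<^sub>-\<^sub>1))\<close>, and \<open>R/(I + (f\<^sub>1,\<dots>,f\<^sub>r))\<close> is nonzero.\<close>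

definition regular_seq_on_quot :: "('n, 'k::field) mpoly set \<Rightarrow> ('n, 'k) mpoly list \<Rightarrow> bool"
  where "regular_seq_on_quot I fs \<longleftrightarrow>
    (\<forall>i<length fs. \<forall>g. fs ! i * g \<in> Idl\<^bsub>polyring\<^esub> (I \<union> set (take i fs)) \<longrightarrow>
        g \<in> Idl\<^bsub>polyring\<^esub> (I \<union> set (take i fs))) \<and>
    Idl\<^bsub>polyring\<^esub> (I \<union> set fs) \<noteq> UNIV"

text \<open>\<open>depth_quot I\<close> is \<open>depth(R/I)\<close>, the maximal length of an \<open>R/I\<close>-regular sequence in the
  homogeneous maximal ideal. It is meant for proper ideals \<open>I\<close>.\<close>

definition depth_quot :: "('n, 'k::field) mpoly set \<Rightarrow> enat"
  where "depth_quot I =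
    (SUP fs\<in>{fs. set fs \<subseteq> max_ideal \<and> regular_seq_on_quot I fs}. enat (length fs))"

definition dstab :: "('n, 'k::field) mpoly set \<Rightarrow> nat"
  where "dstab I = (LEAST k0. 1 \<le> k0 \<and>
    (\<forall>k\<ge>k0. depth_quot (ideal_power I k) = depth_quot (ideal_power I k0)))"

text \<open>\<open>Ass I\<close> denotes the associated primes of \<open>R/I\<close>: the primes of the form \<open>I : f\<close>.\<close>

definition Ass :: "('n, 'k::field) mpoly set \<Rightarrow> ('n, 'k) mpoly set set"
  where "Ass I = {P. primeideal P polyring \<and> (\<exists>f. P = {g. g * f \<in> I})}"

end

theory Submission
  imports Defs
begin

text \<open>Let \<open>S\<close> be the set of exponents of the generators of \<open>I\<close>. If some \<open>l \<in> S\<close> has a unique largest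
  entry, at \<open>m\<close>, then \<open>x\<^bsup>k l\<^esup>/x\<^sub>m\<close> is a socle element of \<open>R/I\<^sup>k\<close> and all depths are zero. Otherwise
  let \<open>c\<close> be the largest entry occurring in \<open>S\<close>. An element of \<open>S\<close> with the fewest entries equal to
  \<open>c\<close> has all its entries in \<open>{c - 1, c}\<close>, as a further shift would lower their number; let
  \<open>D \<le> n - 2\<close> be the number of entries \<open>c - 1\<close>. Then \<open>depth (R/I\<^sup>k) = max 0 (n - 1 - k D)\<close> for all
  \<open>k \<ge> 1\<close>, and \<open>D = 0\<close> exactly if \<open>I\<close> is principal.

  A generator with \<open>r\<close> maximal entries, whose shifts from a maximal to a smaller entry all lie in the
  ideal, yields a nonzero Koszul cohomology class in degree \<open>r - 1\<close>; so the depth is at most \<open>r - 1\<close>. Conversely the first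
  \<open>n - 1 - k D\<close> elementary symmetric polynomials form a regular sequence on \<open>R/I\<^sup>k\<close>: this module has
  a filtration with quotients polynomial rings in at least as many of the variables.\<close>

section \<open>Ideals and weakly regular sequences in a commutative ring\<close>

text \<open>The nonzero pieces into which \<open>R/I^k\<close> is cut are polynomial rings in
  varying subsets of the variables, and one and the same sequence has to be regular on all of them.
  The elementary symmetric polynomials achieve this over every field, also over a finite one, where
  linear forms in general position may be missing. Their regularity is lifted from the quotient by a
  variable back to the ring, which works because all ideals involved are graded.

  Outside the case of a unique largest entry, \<open>n c = d + D\<close> for the common degree
  \<open>d\<close> of the generators. An exponent of a \<open>k\<close>-fold product has degree
  \<open>k d\<close>, so it lies exactly \<open>k D\<close> below the constant vector
  \<open>k c\<close>; this is why each power costs \<open>D\<close>. The case of a unique largest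
  entry obeys the same depth formula, read with \<open>D = n - 1\<close>.\<close>

definition idl :: "'a::comm_ring_1 set \<Rightarrow> bool"
  where "idl J \<longleftrightarrow> 0 \<in> J \<and> (\<forall>a\<in>J. \<forall>b\<in>J. a + b \<in> J) \<and> (\<forall>a\<in>J. \<forall>r. r * a \<in> J)"

lemma idl_zero: "idl J \<Longrightarrow> 0 \<in> J"
  and idl_add: "idl J \<Longrightarrow> a \<in> J \<Longrightarrow> b \<in> J \<Longrightarrow> a + b \<in> J"
  and idl_mult: "idl J \<Longrightarrow> a \<in> J \<Longrightarrow> r * a \<in> J"
  and idl_mult_right: "idl J \<Longrightarrow> a \<in> J \<Longrightarrow> a * r \<in> J"
  unfolding idl_def by (auto simp: mult.commute)

lemma idl_uminus: "idl J \<Longrightarrow> a \<in> J \<Longrightarrow> - a \<in> J"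
  using idl_mult[of J a "-1"] by simp

lemma idl_diff: "idl J \<Longrightarrow> a \<in> J \<Longrightarrow> b \<in> J \<Longrightarrow> a - b \<in> J"
  using idl_add[of J a "- b"] idl_uminus[of J b] by simp

lemma idl_sum:
  assumes "idl J" "\<And>i. i \<in> A \<Longrightarrow> f i \<in> J"
  shows "sum f A \<in> J"
  using assms(2)
  by (induction A rule: infinite_finite_induct) (auto simp: idl_zero idl_add assms(1))

lemma idl_cong: "idl J \<Longrightarrow> a - b \<in> J \<Longrightarrow> a \<in> J \<longleftrightarrow> b \<in> J"
  using idl_add[of J "a - b" b] idl_diff[of J a "a - b"] by auto

text \<open>Bridge between the record-based ideals of the definitions and plain subsets of a
  type-class ring, where the simplifier can calculate.\<close>

lemma ideal_iff_idl: "ideal J (ring_of_type_algebra :: 'a::comm_ring_1 ring) \<longleftrightarrow> idl J"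
proof
  assume "ideal J (ring_of_type_algebra :: 'a ring)"
  then interpret ideal J "ring_of_type_algebra :: 'a ring" .
  show "idl J"
    unfolding idl_def
    using additive_subgroup.zero_closed[OF is_additive_subgroup]
      additive_subgroup.a_closed[OF is_additive_subgroup] I_l_closed
    by (auto simp: ring_of_type_algebra_def)
next
  assume J: "idl J"
  interpret R: cring "ring_of_type_algebra :: 'a ring"
    by (rule cring_from_type_algebra)
  show "ideal J (ring_of_type_algebra :: 'a ring)"
  proof (rule idealI)
    show "ring (ring_of_type_algebra :: 'a ring)" by (rule ring_from_type_algebra)
    show "subgroup J (add_monoid (ring_of_type_algebra :: 'a ring))"
    proof (rule R.add.subgroupI)
      fix a assume "a \<in> J"
      moreover have "\<ominus>\<^bsub>ring_of_type_algebra\<^esub> a = - a"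
        by (rule R.minus_equality) (auto simp: ring_of_type_algebra_def)
      ultimately show "\<ominus>\<^bsub>ring_of_type_algebra\<^esub> a \<in> J"
        using idl_uminus[OF J] by simp
    qed (use idl_zero[OF J] idl_add[OF J] in \<open>auto simp: ring_of_type_algebra_def\<close>)
  qed (use J idl_mult idl_mult_right in \<open>auto simp: ring_of_type_algebra_def\<close>)
qed

lemma genideal_eq:
  "Idl\<^bsub>ring_of_type_algebra\<^esub> S = \<Inter>{J. idl J \<and> S \<subseteq> (J :: 'a::comm_ring_1 set)}"
  unfolding genideal_def ideal_iff_idl ..

lemma genideal_eqI:
  assumes "idl J" "S \<subseteq> J" "\<And>J'. idl J' \<Longrightarrow> S \<subseteq> J' \<Longrightarrow> J \<subseteq> J'"
  shows "Idl\<^bsub>ring_of_type_algebra\<^esub> S = J"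
  unfolding genideal_eq using assms by blast

lemma idl_genideal: "idl (Idl\<^bsub>ring_of_type_algebra\<^esub> S)"
  unfolding genideal_eq idl_def by blast

lemma genideal_superset: "(S :: 'a::comm_ring_1 set) \<subseteq> Idl\<^bsub>ring_of_type_algebra\<^esub> S"
  unfolding genideal_eq by blast

lemma genideal_of_idl: "idl J \<Longrightarrow> Idl\<^bsub>ring_of_type_algebra\<^esub> J = J"
  by (rule genideal_eqI) auto

text \<open>The ideal J + (t). The explicit cofactor \<open>b\<close> is what the regularity
  arguments extract and divide further.\<close>

definition adj :: "'a::comm_ring_1 set \<Rightarrow> 'a \<Rightarrow> 'a set"
  where "adj J t = {j + t * b | j b. j \<in> J}"

lemma adjI: "g - t * b \<in> J \<Longrightarrow> g \<in> adj J t"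
  unfolding adj_def by (rule CollectI, rule exI[of _ "g - t * b"], rule exI[of _ b]) simp

lemma adjE:
  assumes "g \<in> adj J t"
  obtains b where "g - t * b \<in> J"
proof -
  from assms obtain j b where "g = j + t * b" "j \<in> J" unfolding adj_def by blast
  then show ?thesis using that[of b] by simp
qed

lemma idl_adj:
  assumes "idl J"
  shows "idl (adj J t)"
  unfolding idl_def
proof (intro conjI ballI allI)
  show "0 \<in> adj J t" using idl_zero[OF assms] by (intro adjI[of _ _ 0]) simp
next
  fix a b assume "a \<in> adj J t" "b \<in> adj J t"
  then obtain u v where "a - t * u \<in> J" "b - t * v \<in> J" by (meson adjE)
  from idl_add[OF assms this] show "a + b \<in> adj J t"
    by (intro adjI[of _ _ "u + v"]) (simp add: algebra_simps)
next
  fix a r assume "a \<in> adj J t"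
  then obtain u where "a - t * u \<in> J" by (meson adjE)
  from idl_mult[OF assms this, of r] show "r * a \<in> adj J t"
    by (intro adjI[of _ _ "r * u"]) (simp add: algebra_simps)
qed

lemma subset_adj: "J \<subseteq> adj J t"
  by (auto intro: adjI[of _ _ 0])

lemma mem_adj: "idl J \<Longrightarrow> t \<in> adj J t"
  by (rule adjI[of _ _ 1]) (simp add: idl_zero)

lemma adj_least:
  assumes "idl J'" "J \<subseteq> J'" "t \<in> J'"
  shows "adj J t \<subseteq> J'"
proof
  fix g assume "g \<in> adj J t"
  then obtain b where "g - t * b \<in> J" by (rule adjE)
  then have "(g - t * b) + t * b \<in> J'"
    using assms by (intro idl_add idl_mult_right) auto
  then show "g \<in> J'" by simp
qed

lemma genideal_insert: "Idl\<^bsub>ring_of_type_algebra\<^esub> (insert t S) = adj (Idl\<^bsub>ring_of_type_algebra\<^esub> S) t"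
proof (rule genideal_eqI)
  show "insert t S \<subseteq> adj (Idl\<^bsub>ring_of_type_algebra\<^esub> S) t"
    using subset_trans[OF genideal_superset subset_adj] mem_adj[OF idl_genideal, of t S] by simp
next
  fix J' assume "idl J'" "insert t S \<subseteq> J'"
  then show "adj (Idl\<^bsub>ring_of_type_algebra\<^esub> S) t \<subseteq> J'"
    by (intro adj_least) (auto simp: genideal_eq)
qed (rule idl_adj[OF idl_genideal])

lemma adj_commute:
  assumes "idl J"
  shows "adj (adj J s) t = adj (adj J t) s"
  by (intro equalityI adj_least idl_adj assms)
     (use subset_adj[of J] subset_adj[of "adj J _"] mem_adj[OF assms] mem_adj[OF idl_adj[OF assms]]
       in blast)+

fun wreg :: "'a::comm_ring_1 set \<Rightarrow> 'a list \<Rightarrow> bool" where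
  "wreg J [] \<longleftrightarrow> True"
| "wreg J (t # ts) \<longleftrightarrow> (\<forall>g. t * g \<in> J \<longrightarrow> g \<in> J) \<and> wreg (adj J t) ts"

lemma wreg_append: "wreg J (ts @ us) \<longleftrightarrow> wreg J ts \<and> wreg (foldl adj J ts) us"
  by (induction ts arbitrary: J) auto

lemma wreg_UNIV: "wreg UNIV ts"
proof (induction ts)
  case (Cons t ts)
  have "adj UNIV t = UNIV" using subset_adj[of UNIV t] by auto
  with Cons show ?case by simp
qed simp

lemma genideal_Un_list:
  assumes "idl J"
  shows "Idl\<^bsub>ring_of_type_algebra\<^esub> (J \<union> set ts) = foldl adj J ts"
proof (induction ts rule: rev_induct)
  case (snoc t ts)
  then show ?case using genideal_insert[of t "J \<union> set ts"] by simp
qed (simp add: genideal_of_idl[OF assms])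

lemma wreg_iff_nth:
  "wreg J ts \<longleftrightarrow> (\<forall>i<length ts. \<forall>g. ts ! i * g \<in> foldl adj J (take i ts) \<longrightarrow>
     g \<in> foldl adj J (take i ts))"
proof (induction ts arbitrary: J)
  case (Cons t ts)
  then show ?case by (auto simp: less_Suc_eq_0_disj)
qed simp

text \<open>Weak regularity passes from the outer terms of
  \<open>0 \<rightarrow> R/(J : u) \<rightarrow> R/J \<rightarrow> R/(J + (u)) \<rightarrow> 0\<close> to the middle one, because
  \<open>J + (t) : u = (J : u) + (t)\<close> when \<open>t\<close> is regular modulo \<open>J + (u)\<close>.\<close>

lemma wreg_colon_adj:
  assumes "idl J" "wreg {a. a * u \<in> J} ts" "wreg (adj J u) ts"
  shows "wreg J ts"
  using assms
proof (induction ts arbitrary: J)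
  case (Cons t ts)
  note J = Cons.prems(1)
  have col: "idl {a. a * u \<in> J}"
    using J unfolding idl_def by (auto simp: algebra_simps)
  have reg1: "a * u \<in> J" if "t * a * u \<in> J" for a
    using Cons.prems(2) that by auto
  have reg2: "a \<in> adj J u" if "t * a \<in> adj J u" for a
    using Cons.prems(3) that by auto
  have "g \<in> J" if "t * g \<in> J" for g
  proof -
    have "t * g \<in> adj J u" using that subset_adj by blast
    then obtain h where h: "g - u * h \<in> J" using reg2 by (meson adjE)
    have "t * (u * h) \<in> J" using idl_mult[OF J h, of t] that idl_cong[OF J, of "t * g" "t * (u * h)"]
      by (simp add: algebra_simps)
    then have "u * h \<in> J" using reg1[of h] by (simp add: mult_ac)
    then show ?thesis using h idl_cong[OF J] by blast
  qed
  moreover have "adj {a. a * u \<in> J} t = {a. a * u \<in> adj J t}"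
  proof (intro equalityI adj_least)
    show "idl {a. a * u \<in> adj J t}"
      using idl_adj[OF J, of t] unfolding idl_def by (auto simp: algebra_simps)
    show "{a. a * u \<in> J} \<subseteq> {a. a * u \<in> adj J t}" using subset_adj by blast
    show "t \<in> {a. a * u \<in> adj J t}"
      using idl_mult_right[OF idl_adj[OF J] mem_adj[OF J]] by simp
    show "{a. a * u \<in> adj J t} \<subseteq> adj {a. a * u \<in> J} t"
    proof
      fix a assume "a \<in> {a. a * u \<in> adj J t}"
      then obtain b where b: "a * u - t * b \<in> J" by (auto elim: adjE)
      have "t * b \<in> adj J u"
        using idl_uminus[OF J b] by (intro adjI[of _ _ a]) (simp add: mult_ac)
      then obtain c where c: "b - u * c \<in> J" using reg2 by (meson adjE)
      have "(a - t * c) * u \<in> J"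
        using idl_add[OF J b idl_mult[OF J c, of t]] by (simp add: algebra_simps)
      then show "a \<in> adj {a. a * u \<in> J} t" by (intro adjI) simp
    qed
  qed
  moreover have "adj (adj J u) t = adj (adj J t) u" by (rule adj_commute[OF J])
  ultimately show ?case
    using Cons.IH[OF idl_adj[OF J]] Cons.prems(2,3) by simp
qed simp

text \<open>The separation hypothesis makes \<open>x\<close> and a sequence commute: if \<open>x\<close> is regular modulo \<open>J\<close> and
  \<open>t\<close> is regular modulo \<open>J + (x)\<close>, then \<open>t g \<in> J\<close> forces \<open>g \<in> J + (x\<^sup>k)\<close> for all \<open>k\<close>.\<close>

lemma wreg_swap:
  assumes "idl J" "\<And>g. x * g \<in> J \<Longrightarrow> g \<in> J" "wreg (adj J x) ts"
    and sep: "\<And>i g. i < length ts \<Longrightarrow> (\<And>k. g \<in> adj (foldl adj J (take i ts)) (x ^ k)) \<Longrightarrow>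
      g \<in> foldl adj J (take i ts)"
  shows "wreg J ts \<and> (\<forall>g. x * g \<in> foldl adj J ts \<longrightarrow> g \<in> foldl adj J ts)"
  using assms
proof (induction ts arbitrary: J)
  case (Cons t ts)
  note J = Cons.prems(1) and x = Cons.prems(2) and sep = Cons.prems(4)
  have t: "a \<in> adj J x" if "t * a \<in> adj J x" for a
    using Cons.prems(3) that by auto
  have reg: "g \<in> J" if "t * g \<in> J" for g
  proof -
    \<comment> \<open>Keeping \<open>t * h \<in> J\<close> for the cofactor is what allows the next
      factor \<open>x\<close> to be split off.\<close>
    have "\<exists>h. g - x ^ k * h \<in> J \<and> t * h \<in> J" for k
    proof (induction k)
      case 0
      then show ?case using that idl_zero[OF J] by (intro exI[of _ g]) simp
    next
      case (Suc k)
      then obtain h where h: "g - x ^ k * h \<in> J" "t * h \<in> J" by blast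
      then have "t * h \<in> adj J x" using subset_adj by blast
      then obtain h' where h': "h - x * h' \<in> J" using t by (meson adjE)
      have "x * (t * h') \<in> J"
        using idl_cong[OF J, of "t * h" "x * (t * h')"] idl_mult[OF J h', of t] h(2)
        by (simp add: algebra_simps)
      then have "t * h' \<in> J" by (rule x)
      moreover have "g - x ^ Suc k * h' \<in> J"
        using idl_add[OF J h(1) idl_mult[OF J h', of "x ^ k"]] by (simp add: algebra_simps)
      ultimately show ?case by blast
    qed
    then have "g \<in> adj J (x ^ k)" for k by (meson adjI)
    then show ?thesis using sep[of 0 g] by simp
  qed
  \<comment> \<open>The other half of the exchange: \<open>x\<close> stays regular modulo J + (t),
    as the induction hypothesis requires.\<close>
  have x': "g \<in> adj J t" if "x * g \<in> adj J t" for g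
  proof -
    from that obtain w where w: "x * g - t * w \<in> J" by (meson adjE)
    have "t * w \<in> adj J x"
      using idl_uminus[OF J w] by (intro adjI[of _ _ g]) simp
    then obtain w' where w': "w - x * w' \<in> J" using t by (meson adjE)
    have "x * (g - t * w') \<in> J"
      using idl_add[OF J w idl_mult[OF J w', of t]] by (simp add: algebra_simps)
    then show ?thesis using x by (meson adjI)
  qed
  have sep': "g \<in> foldl adj (adj J t) (take i ts)"
    if "i < length ts" "\<And>k. g \<in> adj (foldl adj (adj J t) (take i ts)) (x ^ k)" for i g
  proof -
    have "g \<in> foldl adj J (take (Suc i) (t # ts))"
      by (rule sep) (use that in simp_all)
    then show ?thesis by simp
  qed
  have "wreg (adj (adj J t) x) ts"
    using Cons.prems(3) adj_commute[OF J] by simp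
  from Cons.IH[OF idl_adj[OF J] x' this sep'] have
    "wreg (adj J t) ts" "\<forall>g. x * g \<in> foldl adj J (t # ts) \<longrightarrow> g \<in> foldl adj J (t # ts)"
    unfolding foldl.simps by blast+
  moreover have "\<forall>g. t * g \<in> J \<longrightarrow> g \<in> J" using reg by blast
  ultimately show ?case unfolding wreg.simps by blast
qed simp

section \<open>The Koszul complex\<close>

definition ksgn :: "'n::linorder \<Rightarrow> 'n set \<Rightarrow> 'a::comm_ring_1"
  where "ksgn i H = (-1) ^ card {j \<in> H. j < i}"

text \<open>A cochain \<open>z\<close> gives for each set \<open>H\<close> the coefficient of the
  basis element e_H of the exterior algebra, and \<open>kdiff x\<close> is left multiplication by
  the sum of the x_i e_i. One function carries all degrees; the degree appears only as
  \<open>card H\<close>.\<close>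

definition kdiff :: "('n \<Rightarrow> 'a) \<Rightarrow> ('n::{finite,linorder} set \<Rightarrow> 'a) \<Rightarrow> 'n set \<Rightarrow> 'a::comm_ring_1"
  where "kdiff x z H = (\<Sum>i\<in>H. ksgn i H * x i * z (H - {i}))"

text \<open>Contraction with the linear form that takes the value \<open>g i\<close> on e_i.\<close>

definition khom :: "('n \<Rightarrow> 'a) \<Rightarrow> ('n::{finite,linorder} set \<Rightarrow> 'a) \<Rightarrow> 'n set \<Rightarrow> 'a::comm_ring_1"
  where "khom g z H = (\<Sum>i\<in>-H. ksgn i H * g i * z (insert i H))"

lemma ksgn_square: "ksgn i H * (ksgn i H :: 'a::comm_ring_1) = 1"
  by (simp add: ksgn_def flip: power_mult_distrib)

lemma ksgn_insert_less:
  fixes H :: "'n::{finite,linorder} set"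
  assumes "j \<notin> H" "j < i"
  shows "ksgn i (insert j H) = (- ksgn i H :: 'a::comm_ring_1)"
proof -
  have "{k \<in> insert j H. k < i} = insert j {k \<in> H. k < i}" using assms(2) by auto
  then show ?thesis using assms(1) by (simp add: ksgn_def)
qed

lemma ksgn_insert_geq: "\<not> j < i \<Longrightarrow> ksgn i (insert j H) = ksgn i H"
  unfolding ksgn_def by (rule arg_cong[where f = "\<lambda>A. (-1) ^ card A"]) auto

lemma ksgn_remove_less:
  fixes H :: "'n::{finite,linorder} set"
  assumes "j \<in> H" "j < i"
  shows "ksgn i (H - {j}) = (- ksgn i H :: 'a::comm_ring_1)"
  using ksgn_insert_less[of j "H - {j}" i, where ?'a = 'a] assms by (simp add: insert_absorb)

lemma ksgn_remove_geq: "\<not> j < i \<Longrightarrow> ksgn i (H - {j}) = ksgn i H"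
  unfolding ksgn_def by (rule arg_cong[where f = "\<lambda>A. (-1) ^ card A"]) auto

text \<open>Removing \<open>i\<close> then \<open>j\<close> cancels against removing
  \<open>j\<close> then \<open>i\<close>: of the two signs, only that of the larger index
  changes.\<close>

lemma kdiff_square:
  fixes x :: "'n::{finite,linorder} \<Rightarrow> 'a::comm_ring_1"
  shows "kdiff x (kdiff x z) H = 0"
proof -
  define a where "a i j = ksgn i H * ksgn j (H - {i}) * x i * x j * z (H - {i} - {j})" for i j
  have anti: "a j i = - a i j" if "i \<in> H" "j \<in> H" "i < j" for i j
  proof -
    have "ksgn j (H - {i}) = (- ksgn j H :: 'a)" "ksgn i (H - {j}) = (ksgn i H :: 'a)"
      using that by (simp_all add: ksgn_remove_less ksgn_remove_geq)
    moreover have "H - {i} - {j} = H - {j} - {i}" by auto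
    ultimately show ?thesis by (simp add: a_def algebra_simps)
  qed
  define P where "P = {(i, j). i \<in> H \<and> j \<in> H \<and> i < j}"
  have "kdiff x (kdiff x z) H = (\<Sum>i\<in>H. \<Sum>j\<in>H - {i}. a i j)"
    by (simp add: kdiff_def a_def sum_distrib_left mult_ac)
  also have "\<dots> = (\<Sum>(i, j)\<in>(SIGMA i:H. H - {i}). a i j)"
    by (rule sum.Sigma) auto
  also have "(SIGMA i:H. H - {i}) = P \<union> prod.swap ` P"
    by (auto simp: P_def image_iff)
  also have "(\<Sum>(i, j)\<in>P \<union> prod.swap ` P. a i j) =
      (\<Sum>(i, j)\<in>P. a i j) + (\<Sum>(i, j)\<in>prod.swap ` P. a i j)"
    by (rule sum.union_disjoint) (auto simp: P_def)
  also have "(\<Sum>(i, j)\<in>prod.swap ` P. a i j) = (\<Sum>(i, j)\<in>P. a j i)"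
    by (subst sum.reindex) (auto simp: case_prod_unfold)
  also have "(\<Sum>(i, j)\<in>P. a i j) + (\<Sum>(i, j)\<in>P. a j i) = (\<Sum>(i, j)\<in>P. a i j + a j i)"
    by (simp add: sum.distrib case_prod_unfold)
  also have "\<dots> = 0"
    by (rule sum.neutral) (auto simp: P_def anti)
  finally show ?thesis .
qed

text \<open>The mixed terms \<open>b i j\<close>, with \<open>i\<close> removed and \<open>j\<close>
  inserted, occur in the two compositions with opposite signs. What remains restores
  \<open>H\<close>: the indices in \<open>H\<close> come from the first composition, those outside
  from the second.\<close>

lemma kdiff_khom:
  fixes x :: "'n::{finite,linorder} \<Rightarrow> 'a::comm_ring_1"
  shows "kdiff x (khom g z) H + khom g (kdiff x z) H = (\<Sum>i\<in>UNIV. g i * x i) * z H"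
proof -
  define b where "b i j = ksgn i H * ksgn j (H - {i}) * x i * g j * z (insert j (H - {i}))" for i j
  have 1: "kdiff x (khom g z) H = (\<Sum>i\<in>H. g i * x i * z H) + (\<Sum>i\<in>H. \<Sum>j\<in>-H. b i j)"
  proof -
    have "ksgn i H * x i * khom g z (H - {i}) = g i * x i * z H + (\<Sum>j\<in>-H. b i j)" if "i \<in> H" for i
    proof -
      have "- (H - {i}) = insert i (- H)" using that by auto
      then have "khom g z (H - {i}) =
          ksgn i (H - {i}) * g i * z (insert i (H - {i})) +
          (\<Sum>j\<in>-H. ksgn j (H - {i}) * g j * z (insert j (H - {i})))"
        using that by (simp add: khom_def)
      moreover have "ksgn i (H - {i}) = (ksgn i H :: 'a)" by (simp add: ksgn_remove_geq)
      moreover have "insert i (H - {i}) = H" using that by auto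
      ultimately have "ksgn i H * x i * khom g z (H - {i}) =
          (ksgn i H * ksgn i H) * (g i * x i * z H) + (\<Sum>j\<in>-H. b i j)"
        by (simp add: b_def algebra_simps sum_distrib_left)
      then show ?thesis by (simp only: ksgn_square mult_1)
    qed
    then show ?thesis by (simp add: kdiff_def sum.distrib)
  qed
  have 2: "khom g (kdiff x z) H = (\<Sum>j\<in>-H. g j * x j * z H) - (\<Sum>j\<in>-H. \<Sum>i\<in>H. b i j)"
  proof -
    have "ksgn j H * g j * kdiff x z (insert j H) = g j * x j * z H - (\<Sum>i\<in>H. b i j)" if "j \<notin> H" for j
    proof -
      have "kdiff x z (insert j H) = ksgn j (insert j H) * x j * z (insert j H - {j}) +
          (\<Sum>i\<in>H. ksgn i (insert j H) * x i * z (insert j H - {i}))"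
        using that by (simp add: kdiff_def)
      moreover have "ksgn j (insert j H) = (ksgn j H :: 'a)" by (simp add: ksgn_insert_geq)
      moreover have "insert j H - {j} = H" using that by auto
      moreover have "ksgn j H * g j * (ksgn i (insert j H) * x i * z (insert j H - {i})) = - b i j"
        if "i \<in> H" for i
      proof -
        have "insert j H - {i} = insert j (H - {i})" "i \<noteq> j" using that \<open>j \<notin> H\<close> by auto
        moreover have "ksgn j H * ksgn i (insert j H) = (- (ksgn i H * ksgn j (H - {i})) :: 'a)"
          using that \<open>j \<notin> H\<close> \<open>i \<noteq> j\<close>
          by (cases "i < j")
             (simp_all add: ksgn_remove_less ksgn_remove_geq ksgn_insert_less ksgn_insert_geq)
        moreover have "ksgn j H * g j * (ksgn i (insert j H) * x i * z (insert j (H - {i}))) =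
            (ksgn j H * ksgn i (insert j H)) * (x i * g j * z (insert j (H - {i})))"
          by (simp only: mult_ac)
        ultimately show ?thesis by (simp add: b_def mult.assoc)
      qed
      ultimately have "ksgn j H * g j * kdiff x z (insert j H) =
          (ksgn j H * ksgn j H) * (g j * x j * z H) + (\<Sum>i\<in>H. - b i j)"
        by (simp add: distrib_left sum_distrib_left mult_ac)
      then show ?thesis by (simp add: ksgn_square sum_negf)
    qed
    then show ?thesis by (simp add: khom_def sum_subtractf)
  qed
  have "(\<Sum>i\<in>UNIV. g i * x i) = (\<Sum>i\<in>H. g i * x i) + (\<Sum>i\<in>-H. g i * x i)"
    using sum.union_disjoint[of H "- H" "\<lambda>i. g i * x i"] by simp
  then show ?thesis
    unfolding 1 2 using sum.swap[of b H "- H"] sum.swap[of "\<lambda>i j. b j i" H "-H"]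
    by (simp add: algebra_simps sum_distrib_left sum_distrib_right sum.swap[of b "- H" H])
qed

lemma kdiff_diff: "kdiff x (\<lambda>H. z H - w H) H = kdiff x z H - kdiff x w H"
  by (simp add: kdiff_def right_diff_distrib sum_subtractf)

lemma kdiff_scale: "kdiff x (\<lambda>H. t * z H) H = t * kdiff x z H"
  by (simp add: kdiff_def sum_distrib_left mult_ac)

lemma kdiff_mem:
  assumes "idl J" "\<And>i. i \<in> H \<Longrightarrow> z (H - {i}) \<in> J"
  shows "kdiff x z H \<in> J"
  unfolding kdiff_def using assms by (intro idl_sum) (auto intro: idl_mult)

text \<open>Koszul cohomology of \<open>R/J\<close> vanishes below the length of a regular sequence: multiplication by
  its first element \<open>t\<close> is null-homotopic, so a cocycle \<open>z\<close> gives the cocycle \<open>khom g z\<close> modulo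
  \<open>J + (t)\<close> in one degree less.\<close>

lemma koszul_exact:
  fixes x :: "'n::{finite,linorder} \<Rightarrow> 'a::comm_ring_1"
  assumes "idl J" "wreg J ts" "\<forall>t\<in>set ts. \<exists>g. t = (\<Sum>i\<in>UNIV. g i * x i)"
    and "p < length ts" "\<And>H. card H = Suc p \<Longrightarrow> kdiff x z H \<in> J"
  shows "\<exists>w. \<forall>H. card H = p \<longrightarrow> z H - kdiff x w H \<in> J"
  using assms
proof (induction ts arbitrary: J p z)
  case (Cons t ts)
  note J = Cons.prems(1)
  have reg: "a \<in> J" if "t * a \<in> J" for a using Cons.prems(2) that by simp
  obtain g where t: "t = (\<Sum>i\<in>UNIV. g i * x i)" using Cons.prems(3) by auto
  have hdz: "khom g (kdiff x z) H \<in> J" if "card H = p" for H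
    unfolding khom_def
    using that by (intro idl_sum[OF J] idl_mult[OF J] Cons.prems(5)) simp
  have dhz: "t * z H - kdiff x (khom g z) H \<in> J" if "card H = p" for H
  proof -
    have "t * z H - kdiff x (khom g z) H = khom g (kdiff x z) H"
      using kdiff_khom[of x g z H] unfolding t[symmetric] by (metis add_diff_cancel_left')
    then show ?thesis using hdz[OF that] by simp
  qed
  show ?case
  proof (cases p)
    case 0
    have "z {} \<in> J"
    proof (rule reg)
      show "t * z {} \<in> J" using dhz[of "{}"] 0 by (simp add: kdiff_def)
    qed
    then show ?thesis using 0 by (intro exI[of _ "\<lambda>_. 0"]) (simp add: kdiff_def)
  next
    case (Suc q)
    have "kdiff x (khom g z) H \<in> adj J t" if "card H = Suc q" for H
      using idl_uminus[OF J dhz[of H]] that Suc by (intro adjI[of _ _ "z H"]) simp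
    then obtain v where v: "\<forall>H. card H = q \<longrightarrow> khom g z H - kdiff x v H \<in> adj J t"
      using Cons.IH[OF idl_adj[OF J], of t q "khom g z"] Cons.prems Suc by auto
    then have "\<forall>H. \<exists>b. card H = q \<longrightarrow> khom g z H - kdiff x v H - t * b \<in> J"
      by (meson adjE)
    \<comment> \<open>The cofactor \<open>u\<close> is the primitive sought: applying
      \<open>kdiff\<close> kills the term with \<open>v\<close>, and then \<open>t\<close> can be
      cancelled.\<close>
    then obtain u where u: "\<And>H. card H = q \<Longrightarrow> khom g z H - kdiff x v H - t * u H \<in> J"
      by metis
    have "z H - kdiff x u H \<in> J" if H: "card H = p" for H
    proof (rule reg)
      have "kdiff x (\<lambda>H. khom g z H - kdiff x v H - t * u H) H \<in> J"
        using H Suc by (intro kdiff_mem[OF J] u) simp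
      then have "kdiff x (khom g z) H - t * kdiff x u H \<in> J"
        by (simp add: kdiff_diff kdiff_scale kdiff_square)
      from idl_add[OF J this dhz[OF H]] show "t * (z H - kdiff x u H) \<in> J"
        by (simp add: algebra_simps)
    qed
    then show ?thesis by blast
  qed
qed simp

section \<open>Monomial ideals\<close>

text \<open>For \<open>upclosed U\<close> these are the monomial ideals, so that ideal membership
  becomes a question about exponents.\<close>

definition monspan :: "'n expo set \<Rightarrow> ('n, 'k::field) mpoly set"
  where "monspan U = {p. Poly_Mapping.keys p \<subseteq> U}"

definition upclosed :: "'n expo set \<Rightarrow> bool"
  where "upclosed U \<longleftrightarrow> (\<forall>a\<in>U. \<forall>b. a + b \<in> U)"

definition up :: "'n expo set \<Rightarrow> 'n expo set"
  where "up S = {a + b | a b. a \<in> S}"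

lemma upI: "a \<in> S \<Longrightarrow> a + b \<in> up S"
  unfolding up_def by blast

lemma subset_up: "S \<subseteq> up S"
  using upI[of _ S 0] by auto

lemma upclosed_up: "upclosed (up S)"
  unfolding upclosed_def up_def by (force simp: add.assoc)

lemma upclosed_Un: "upclosed U \<Longrightarrow> upclosed V \<Longrightarrow> upclosed (U \<union> V)"
  unfolding upclosed_def by blast

lemma up_zero: "0 \<in> S \<Longrightarrow> up S = UNIV"
  using upI[of 0 S] by auto

lemma expo_eq_add_minus: "(\<And>i. Poly_Mapping.lookup a i \<le> Poly_Mapping.lookup b i) \<Longrightarrow> b = a + (b - a)"
  for a b :: "'n expo"
  by (rule poly_mapping_eqI) (simp add: lookup_add lookup_minus)

lemma poly_eq_sum_single:
  "p = (\<Sum>m\<in>Poly_Mapping.keys p. Poly_Mapping.single m (Poly_Mapping.lookup p m))"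
proof (rule poly_mapping_eqI)
  fix k
  show "Poly_Mapping.lookup p k =
      Poly_Mapping.lookup (\<Sum>m\<in>Poly_Mapping.keys p. Poly_Mapping.single m (Poly_Mapping.lookup p m)) k"
    by (cases "k \<in> Poly_Mapping.keys p")
       (auto simp: lookup_sum lookup_single when_def sum.delta in_keys_iff)
qed

lemma single_eq_scale_xpow: "Poly_Mapping.single m c = Poly_Mapping.single 0 c * xpow m"
  by (simp add: xpow_def mult_single)

lemma xpow_add: "xpow (a + b) = xpow a * xpow b"
  by (simp add: xpow_def mult_single)

lemma keys_xpow [simp]: "Poly_Mapping.keys (xpow m :: ('n, 'k::field) mpoly) = {m}"
  by (simp add: xpow_def)

lemma xpow_mem_monspan [simp]: "(xpow m :: ('n, 'k::field) mpoly) \<in> monspan U \<longleftrightarrow> m \<in> U"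
  by (simp add: monspan_def)

lemma idl_monspan:
  assumes "upclosed U"
  shows "idl (monspan U)"
  unfolding idl_def
proof (intro conjI ballI allI)
  show "0 \<in> monspan U" by (simp add: monspan_def)
  show "p + q \<in> monspan U" if "p \<in> monspan U" "q \<in> monspan U" for p q :: "('a, 'b) mpoly"
    using that keys_add[of p q] unfolding monspan_def by blast
  show "r * p \<in> monspan U" if "p \<in> monspan U" for p r :: "('a, 'b) mpoly"
    using that keys_mult[of p r] assms unfolding monspan_def upclosed_def
    by (force simp: mult.commute)
qed

lemma monspan_least:
  assumes "idl J" "xpow ` U \<subseteq> J"
  shows "monspan U \<subseteq> J"
proof
  fix p :: "('a, 'b) mpoly" assume "p \<in> monspan U"
  then have "Poly_Mapping.single m (Poly_Mapping.lookup p m) \<in> J" if "m \<in> Poly_Mapping.keys p" for m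
    using that assms unfolding monspan_def
    by (subst single_eq_scale_xpow) (intro idl_mult; blast)
  then show "p \<in> J"
    by (subst poly_eq_sum_single) (intro idl_sum[OF assms(1)])
qed

lemma genideal_xpow:
  "Idl\<^bsub>polyring\<^esub> (xpow ` S) = (monspan (up S) :: ('n, 'k::field) mpoly set)"
proof (rule genideal_eqI)
  show "idl (monspan (up S) :: ('n, 'k) mpoly set)" by (rule idl_monspan[OF upclosed_up])
  show "xpow ` S \<subseteq> (monspan (up S) :: ('n, 'k) mpoly set)"
    using subsetD[OF subset_up[of S]] by auto
next
  fix J :: "('n, 'k) mpoly set"
  assume J: "idl J" "xpow ` S \<subseteq> J"
  then show "monspan (up S) \<subseteq> J"
    by (intro monspan_least) (auto simp: up_def xpow_add intro!: idl_mult_right)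
qed

lemma keys_mult_xpow:
  "Poly_Mapping.keys (p * xpow u) = (\<lambda>m. m + u) ` Poly_Mapping.keys (p :: ('n, 'k::field) mpoly)"
proof -
  have "p * xpow u = (\<Sum>m\<in>Poly_Mapping.keys p. Poly_Mapping.single (m + u) (Poly_Mapping.lookup p m))"
    by (subst (1) poly_eq_sum_single) (simp add: sum_distrib_right xpow_def mult_single)
  then have "Poly_Mapping.lookup (p * xpow u) k =
      (\<Sum>m\<in>Poly_Mapping.keys p. Poly_Mapping.lookup p m when m + u = k)" for k
    by (simp add: lookup_sum lookup_single)
  then have "Poly_Mapping.lookup (p * xpow u) (m + u) = Poly_Mapping.lookup p m" for m
    by (auto simp: when_def in_keys_iff sum.delta)
  moreover have "Poly_Mapping.keys (p * xpow u) \<subseteq> (\<lambda>m. m + u) ` Poly_Mapping.keys p"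
    using keys_mult[of p "xpow u"] by auto
  ultimately show ?thesis by (force simp: in_keys_iff)
qed

lemma monspan_colon:
  "{p. p * xpow u \<in> monspan U} = (monspan {m. m + u \<in> U} :: ('n, 'k::field) mpoly set)"
  by (auto simp: monspan_def keys_mult_xpow)

lemma monspan_adj:
  assumes "upclosed U"
  shows "adj (monspan U) (xpow u) = (monspan (U \<union> up {u}) :: ('n, 'k::field) mpoly set)"
proof
  have U: "idl (monspan (U \<union> up {u}) :: ('n, 'k) mpoly set)"
    by (intro idl_monspan upclosed_Un assms upclosed_up)
  show "adj (monspan U) (xpow u) \<subseteq> (monspan (U \<union> up {u}) :: ('n, 'k) mpoly set)"
    using subset_up[of "{u}"] by (intro adj_least[OF U]) (auto simp: monspan_def)
  have J: "idl (monspan U :: ('n, 'k) mpoly set)" by (rule idl_monspan[OF assms])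
  have "xpow (u + b) \<in> adj (monspan U) (xpow u :: ('n, 'k) mpoly)" for b
    unfolding xpow_add by (intro idl_mult_right idl_adj J mem_adj)
  moreover have "xpow a \<in> adj (monspan U) (xpow u :: ('n, 'k) mpoly)" if "a \<in> U" for a
    by (rule subsetD[OF subset_adj]) (simp add: that)
  ultimately show "monspan (U \<union> up {u}) \<subseteq> adj (monspan U) (xpow u :: ('n, 'k) mpoly)"
    by (intro monspan_least idl_adj J) (auto simp: up_def)
qed

section \<open>Products and powers of monomial ideals\<close>

fun sumpow :: "'n expo set \<Rightarrow> nat \<Rightarrow> 'n expo set" where
  "sumpow S 0 = {0}"
| "sumpow S (Suc k) = {a + b | a b. a \<in> sumpow S k \<and> b \<in> S}"

lemma ideal_prod_monspan:
  "ideal_prod polyring (monspan (up S)) (monspan (up T)) =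
     (monspan (up {a + b | a b. a \<in> S \<and> b \<in> T}) :: ('n, 'k::field) mpoly set)"
  (is "?L = monspan (up ?ST)")
proof
  have idl: "idl (monspan (up S') :: ('n, 'k) mpoly set)" for S'
    by (rule idl_monspan[OF upclosed_up])
  show "?L \<subseteq> monspan (up ?ST)"
  proof
    fix p assume "p \<in> ?L"
    then show "p \<in> monspan (up ?ST)"
    proof (induction rule: ideal_prod.induct)
      case (prod p q)
      have "Poly_Mapping.keys (p * q) \<subseteq> up ?ST"
      proof
        fix k assume "k \<in> Poly_Mapping.keys (p * q)"
        then obtain a b where ab: "k = a + b" "a \<in> up S" "b \<in> up T"
          using keys_mult[of p q] prod unfolding monspan_def by blast
        then obtain s s' t t' where "a = s + s'" "b = t + t'" "s \<in> S" "t \<in> T"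
          unfolding up_def by blast
        then have "k = (s + t) + (s' + t')" "s + t \<in> ?ST" using ab by (auto simp: add_ac)
        then show "k \<in> up ?ST" by (metis (no_types, lifting) upI)
      qed
      then show ?case by (simp add: monspan_def ring_of_type_algebra_def)
    next
      case (sum p q)
      then show ?case using idl_add[OF idl] by (simp add: ring_of_type_algebra_def)
    qed
  qed
  have L: "idl ?L"
    using ring.ideal_prod_is_ideal[OF ring_from_type_algebra] idl unfolding ideal_iff_idl[symmetric]
    by blast
  show "monspan (up ?ST) \<subseteq> ?L"
  proof (rule monspan_least[OF L], rule subsetI, elim imageE)
    fix p :: "('n, 'k) mpoly" and m assume p: "p = xpow m" and "m \<in> up ?ST"
    then obtain a b c where "m = a + b + c" "a \<in> S" "b \<in> T" unfolding up_def by blast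
    moreover have "xpow (a + c) * xpow b \<in> ?L" if "a \<in> S" "b \<in> T" for a b c
    proof -
      have "(xpow (a + c) :: ('n, 'k) mpoly) \<otimes>\<^bsub>polyring\<^esub> xpow b \<in> ?L"
        using that subset_up[of T] by (intro ideal_prod.prod) (auto intro: upI)
      then show ?thesis by (simp add: ring_of_type_algebra_def)
    qed
    ultimately show "p \<in> ?L" using p by (simp add: xpow_add mult_ac)
  qed
qed

lemma ideal_power_monspan:
  "ideal_power (monspan (up S)) k = (monspan (up (sumpow S k)) :: ('n, 'k::field) mpoly set)"
proof (induction k)
  case 0
  have "carrier polyring = (monspan UNIV :: ('n, 'k) mpoly set)"
    by (simp add: monspan_def ring_of_type_algebra_def)
  then show ?case by (simp add: nat_pow_def ideals_set_def up_zero)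
next
  case (Suc k)
  then show ?case
    by (simp add: nat_pow_def ideals_set_def ideal_prod_monspan)
qed

lemma expo_degree_add: "expo_degree (a + b) = expo_degree a + expo_degree b"
  by (simp add: expo_degree_def lookup_add sum.distrib)

lemma expo_degree_single [simp]: "expo_degree (Poly_Mapping.single i a :: 'n::finite expo) = a"
  by (simp add: expo_degree_def lookup_single when_def)

lemma expo_degree_zero [simp]: "expo_degree 0 = 0"
  by (simp add: expo_degree_def)

lemma expo_degree_eq_0: "expo_degree a = 0 \<longleftrightarrow> a = 0"
  by (auto simp: expo_degree_def intro!: poly_mapping_eqI)

lemma expo_split_single:
  "0 < Poly_Mapping.lookup (l :: 'n expo) i \<Longrightarrow>
    l = (l - Poly_Mapping.single i 1) + Poly_Mapping.single i 1"
  by (rule poly_mapping_eqI) (auto simp: lookup_add lookup_minus lookup_single when_def)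

lemma upclosed_nonzero: "upclosed {m :: 'n expo. m \<noteq> 0}"
  unfolding upclosed_def
  by (auto simp: poly_mapping_eq_iff fun_eq_iff lookup_add)

lemma max_ideal_eq: "(max_ideal :: ('n, 'k::field) mpoly set) = monspan {m. m \<noteq> 0}"
proof -
  have "range var = (xpow ` range (\<lambda>i. Poly_Mapping.single i 1) :: ('n, 'k) mpoly set)"
    by (auto simp: var_def)
  moreover have "up (range (\<lambda>i. Poly_Mapping.single i (1::nat))) = {m. m \<noteq> (0 :: 'n expo)}"
  proof (intro equalityI subsetI)
    fix m :: "'n expo" assume "m \<in> {m. m \<noteq> 0}"
    then obtain i where "0 < Poly_Mapping.lookup m i"
      by (auto simp: poly_mapping_eq_iff fun_eq_iff)
    then show "m \<in> up (range (\<lambda>i. Poly_Mapping.single i 1))"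
      using expo_split_single[of m i] upI[of "Poly_Mapping.single i 1" _ "m - Poly_Mapping.single i 1"]
      by (simp add: add.commute)
  next
    fix m :: "'n expo" assume "m \<in> up (range (\<lambda>i. Poly_Mapping.single i 1))"
    then obtain i b where "m = Poly_Mapping.single i 1 + b" unfolding up_def by blast
    then have "Poly_Mapping.lookup m i \<noteq> 0" by (simp add: lookup_add)
    then show "m \<in> {m. m \<noteq> 0}" by auto
  qed
  ultimately show ?thesis unfolding max_ideal_def using genideal_xpow by metis
qed

lemma idl_max_ideal: "idl (max_ideal :: ('n, 'k::field) mpoly set)"
  unfolding max_ideal_eq by (rule idl_monspan[OF upclosed_nonzero])

lemma max_ideal_neq_UNIV: "(max_ideal :: ('n, 'k::field) mpoly set) \<noteq> UNIV"
  unfolding max_ideal_eq using xpow_mem_monspan[of 0 "{m. m \<noteq> 0}"] by blast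

text \<open>Supplies the coefficients of the null-homotopy in \<open>koszul_exact\<close>.\<close>

lemma max_ideal_linear_combination:
  assumes "t \<in> (max_ideal :: ('n::finite, 'k::field) mpoly set)"
  shows "\<exists>g. t = (\<Sum>i\<in>UNIV. g i * var i)"
proof -
  let ?J = "{t. \<exists>g. t = (\<Sum>i\<in>UNIV. g i * (var i :: ('n, 'k) mpoly))}"
  have "idl ?J"
    unfolding idl_def
  proof (intro conjI ballI allI)
    show "0 \<in> ?J" by (auto intro: exI[of _ "\<lambda>_. 0"])
    fix a b assume "a \<in> ?J" "b \<in> ?J"
    then obtain g h where "a = (\<Sum>i\<in>UNIV. g i * var i)" "b = (\<Sum>i\<in>UNIV. h i * var i)" by blast
    then show "a + b \<in> ?J"
      by (auto intro!: exI[of _ "\<lambda>i. g i + h i"] simp: distrib_right sum.distrib)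
  next
    fix a r assume "a \<in> ?J"
    then obtain g where "a = (\<Sum>i\<in>UNIV. g i * var i)" by blast
    then show "r * a \<in> ?J"
      by (auto intro!: exI[of _ "\<lambda>i. r * g i"] simp: sum_distrib_left mult.assoc)
  qed
  moreover have "range var \<subseteq> ?J"
  proof (rule subsetI, elim rangeE)
    fix j and x :: "('n, 'k) mpoly" assume "x = var j"
    then have "x = (\<Sum>i\<in>UNIV. (if i = j then 1 else 0) * var i)"
      by (simp add: if_distrib[of "\<lambda>y. y * _"] sum.delta cong: if_cong)
    then show "x \<in> ?J" by (intro CollectI exI[of _ "\<lambda>i. if i = j then 1 else 0"])
  qed
  ultimately show ?thesis using assms unfolding max_ideal_def genideal_eq by blast
qed

section \<open>Bounds for the depth\<close>

lemma depth_quot_le: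
  assumes "idl J" "\<And>ts. set ts \<subseteq> max_ideal \<Longrightarrow> wreg J ts \<Longrightarrow> length ts \<le> s"
  shows "depth_quot J \<le> enat s"
  unfolding depth_quot_def
proof (rule SUP_least)
  fix fs assume "fs \<in> {fs. set fs \<subseteq> max_ideal \<and> regular_seq_on_quot J fs}"
  moreover have "wreg J fs" if "regular_seq_on_quot J fs"
    using that unfolding regular_seq_on_quot_def wreg_iff_nth genideal_Un_list[OF assms(1)] by blast
  ultimately show "enat (length fs) \<le> enat s" using assms(2) by simp
qed

text \<open>Containment in the maximal ideal survives adjoining \<open>ts\<close>, and this gives
  the nonzero quotient that \<open>wreg\<close> does not record.\<close>

lemma depth_quot_ge:
  assumes "idl J" "J \<subseteq> max_ideal" "set ts \<subseteq> max_ideal" "wreg J ts"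
  shows "enat (length ts) \<le> depth_quot J"
  unfolding depth_quot_def
proof (rule SUP_upper, intro CollectI conjI)
  have "Idl\<^bsub>polyring\<^esub> (J \<union> set ts) \<subseteq> max_ideal"
    using assms(2,3) idl_max_ideal unfolding genideal_eq by blast
  then show "regular_seq_on_quot J ts"
    using assms(4) max_ideal_neq_UNIV
    unfolding regular_seq_on_quot_def wreg_iff_nth genideal_Un_list[OF assms(1)] by blast
qed (rule assms(3))

text \<open>If \<open>T\<close> is the set of indices where \<open>l\<close> is maximal, then \<open>x\<^sup>l / x\<^sub>m\<close>, placed in degree
  \<open>T - {m}\<close>, is a Koszul cocycle modulo the ideal. It is no coboundary since its Koszul
  differential has the nonzero coefficient \<open>x\<^sup>l\<close>, whose degree \<open>d\<close> is too small.\<close>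

lemma depth_quot_le_card:
  fixes U :: "'n::{finite,linorder} expo set"
  assumes "upclosed U" "\<And>a. a \<in> U \<Longrightarrow> expo_degree l \<le> expo_degree a" "l \<in> U"
    and "m \<in> T" "0 < Poly_Mapping.lookup l m" "\<And>i. i \<notin> T \<Longrightarrow> exch l i m \<in> U"
  shows "depth_quot (monspan U :: ('n, 'k::field) mpoly set) \<le> enat (card T - 1)"
proof (rule depth_quot_le)
  let ?J = "monspan U :: ('n, 'k) mpoly set"
  show J: "idl ?J" by (rule idl_monspan[OF assms(1)])
  define q where "q = l - Poly_Mapping.single m 1"
  have l: "l = q + Poly_Mapping.single m 1"
    unfolding q_def by (rule expo_split_single[OF assms(5)])
  have exch: "exch l i m = q + Poly_Mapping.single i 1" for i
    using assms(5) unfolding exch_def q_def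
    by (intro poly_mapping_eqI) (auto simp: lookup_add lookup_minus lookup_single when_def)
  define G where "G = T - {m}"
  define z :: "'n set \<Rightarrow> ('n, 'k) mpoly" where "z H = (if H = G then xpow q else 0)" for H
  fix ts :: "('n, 'k) mpoly list" assume ts: "set ts \<subseteq> max_ideal" "wreg ?J ts"
  show "length ts \<le> card T - 1"
  proof (rule ccontr)
    assume "\<not> length ts \<le> card T - 1"
    then have len: "card G < length ts" using assms(4) by (simp add: G_def)
    have "\<exists>w. \<forall>H. card H = card G \<longrightarrow> z H - kdiff var w H \<in> ?J"
    proof (rule koszul_exact[OF J ts(2) _ len])
      show "\<forall>t\<in>set ts. \<exists>g. t = (\<Sum>i\<in>UNIV. g i * var i)"
        using ts(1) max_ideal_linear_combination by blast
      fix H :: "'n set" assume H: "card H = Suc (card G)"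
      have "var i * z (H - {i}) \<in> ?J" if i: "i \<in> H" for i
      proof (cases "H - {i} = G")
        case True
        then have "i \<notin> G" by blast
        \<comment> \<open>Either \<open>i = m\<close> and the product is x^l itself, or
          \<open>i \<notin> T\<close> and it is an exchanged monomial.\<close>
        then have "q + Poly_Mapping.single i 1 \<in> U"
          using assms(3) l assms(6)[of i] exch by (cases "i = m") (auto simp: G_def)
        then show ?thesis using True by (simp add: z_def var_def flip: xpow_add add.commute)
      qed (simp add: z_def idl_zero[OF J])
      then show "kdiff var z H \<in> ?J"
        unfolding kdiff_def mult.assoc by (metis (lifting) idl_sum[OF J] idl_mult[OF J])
    qed
    then obtain w where w: "\<And>H. card H = card G \<Longrightarrow> z H - kdiff var w H \<in> ?J" by blast
    \<comment> \<open>Elements of the ideal have at least the degree of \<open>l\<close>, so a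
      variable times such an element lands in \<open>V\<close>, whereas \<open>l\<close> is outside
      \<open>V\<close>.\<close>
    define V where "V = {a :: 'n expo. expo_degree l < expo_degree a}"
    have V: "idl (monspan V :: ('n, 'k) mpoly set)"
      by (rule idl_monspan) (auto simp: upclosed_def V_def expo_degree_add)
    have var_V: "var i * p \<in> monspan V" if "p \<in> ?J" for i and p :: "('n, 'k) mpoly"
      using that assms(2) keys_mult_xpow[of p "Poly_Mapping.single i 1"]
      by (auto simp: monspan_def V_def var_def mult.commute[of _ p] expo_degree_add
            le_imp_less_Suc subset_iff)
    \<comment> \<open>Each \<open>T - {i}\<close> has the size of \<open>G\<close>, so the
      congruence for \<open>w\<close> applies to every summand; \<open>kdiff_square\<close> then
      removes \<open>w\<close>.\<close>
    have "kdiff var (\<lambda>H. z H - kdiff var w H) T \<in> monspan V"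
      unfolding kdiff_def[of _ _ T] mult.assoc
    proof (rule idl_sum[OF V], rule idl_mult[OF V], rule var_V, rule w)
      fix i assume "i \<in> T"
      then show "card (T - {i}) = card G" using assms(4) by (simp add: G_def)
    qed
    then have "kdiff var z T \<in> monspan V" by (simp add: kdiff_diff kdiff_square)
    moreover have "kdiff var z T = ksgn m T * xpow l"
    proof -
      have "kdiff var z T = (\<Sum>i\<in>T. if i = m then ksgn m T * xpow l else 0)"
        unfolding kdiff_def
      proof (rule sum.cong)
        fix i assume "i \<in> T"
        have "T - {i} = G \<longleftrightarrow> i = m" using \<open>i \<in> T\<close> assms(4) by (auto simp: G_def)
        then show "ksgn i T * var i * z (T - {i}) = (if i = m then ksgn m T * xpow l else 0)"
          by (simp add: z_def l xpow_add var_def mult_ac)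
      qed simp
      then show ?thesis using assms(4) by simp
    qed
    ultimately have "ksgn m T * (ksgn m T * xpow l) \<in> (monspan V :: ('n, 'k) mpoly set)"
      using idl_mult[OF V] by metis
    then have "l \<in> V"
      unfolding mult.assoc[symmetric] ksgn_square by simp
    then show False by (simp add: V_def)
  qed
qed

section \<open>Homogeneous ideals\<close>

definition hcomp :: "nat \<Rightarrow> ('n::finite, 'k::field) mpoly \<Rightarrow> ('n, 'k) mpoly"
  where "hcomp d p = (\<Sum>m\<in>{m \<in> Poly_Mapping.keys p. expo_degree m = d}.
    Poly_Mapping.single m (Poly_Mapping.lookup p m))"

definition homog :: "nat \<Rightarrow> ('n::finite, 'k::field) mpoly \<Rightarrow> bool"
  where "homog d p \<longleftrightarrow> (\<forall>m\<in>Poly_Mapping.keys p. expo_degree m = d)"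

definition homog_ideal :: "('n::finite, 'k::field) mpoly set \<Rightarrow> bool"
  where "homog_ideal J \<longleftrightarrow> (\<forall>p\<in>J. \<forall>d. hcomp d p \<in> J)"

lemma lookup_hcomp:
  "Poly_Mapping.lookup (hcomp d p) m = (Poly_Mapping.lookup p m when expo_degree m = d)"
  by (auto simp: hcomp_def lookup_sum lookup_single when_def sum.delta in_keys_iff)

lemma hcomp_diff: "hcomp d (p - q) = hcomp d p - hcomp d q"
  by (rule poly_mapping_eqI) (simp add: lookup_hcomp lookup_minus when_def)

lemma hcomp_homog: "homog d p \<Longrightarrow> hcomp d p = p"
  by (rule poly_mapping_eqI) (auto simp: lookup_hcomp homog_def in_keys_iff when_def)

lemma hcomp_zero: "(\<And>m. m \<in> Poly_Mapping.keys p \<Longrightarrow> expo_degree m \<noteq> d) \<Longrightarrow> hcomp d p = 0"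
  by (rule poly_mapping_eqI) (auto simp: lookup_hcomp in_keys_iff when_def)

lemma homog_hcomp: "homog d (hcomp d p)"
  by (auto simp: homog_def in_keys_iff lookup_hcomp when_def split: if_splits)

lemma homog_mult: "homog d p \<Longrightarrow> homog e q \<Longrightarrow> homog (d + e) (p * q)"
  using keys_mult[of p q] unfolding homog_def by (auto simp: expo_degree_add)

lemma hcomp_mult_homog:
  assumes "homog e t"
  shows "hcomp (e + d) (t * b) = t * hcomp d b"
proof -
  have "hcomp (e + d) (t * (b - hcomp d b)) = 0"
  proof (rule hcomp_zero)
    fix m assume "m \<in> Poly_Mapping.keys (t * (b - hcomp d b))"
    then obtain u v where m: "m = u + v" "u \<in> Poly_Mapping.keys t" "v \<in> Poly_Mapping.keys (b - hcomp d b)"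
      using keys_mult by blast
    then have "expo_degree v \<noteq> d" by (auto simp: in_keys_iff lookup_minus lookup_hcomp)
    then show "expo_degree m \<noteq> e + d" using m assms by (simp add: homog_def expo_degree_add)
  qed
  moreover have "hcomp (e + d) (t * hcomp d b) = t * hcomp d b"
    by (intro hcomp_homog homog_mult assms homog_hcomp)
  ultimately show ?thesis by (simp add: right_diff_distrib hcomp_diff)
qed

lemma hcomp_mult_homog_low:
  assumes "homog e t" "d < e"
  shows "hcomp d (t * b) = 0"
proof (rule hcomp_zero)
  fix m assume "m \<in> Poly_Mapping.keys (t * b)"
  then obtain u v where "m = u + v" "u \<in> Poly_Mapping.keys t"
    using keys_mult by blast
  then show "expo_degree m \<noteq> d" using assms by (simp add: homog_def expo_degree_add)
qed

lemma sum_hcomp: "p = (\<Sum>d\<in>expo_degree ` Poly_Mapping.keys p. hcomp d p)"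
proof (rule poly_mapping_eqI)
  fix m
  show "Poly_Mapping.lookup p m =
      Poly_Mapping.lookup (\<Sum>d\<in>expo_degree ` Poly_Mapping.keys p. hcomp d p) m"
    by (cases "m \<in> Poly_Mapping.keys p")
       (auto simp: lookup_sum lookup_hcomp when_def sum.delta in_keys_iff)
qed

lemma homog_ideal_monspan: "homog_ideal (monspan U)"
  unfolding homog_ideal_def monspan_def
  by (auto simp: in_keys_iff lookup_hcomp subset_iff)

lemma homog_ideal_adj:
  assumes "homog_ideal J" "homog e t" "idl J"
  shows "homog_ideal (adj J t)"
  unfolding homog_ideal_def
proof (intro ballI allI)
  fix p d assume "p \<in> adj J t"
  then obtain b where "p - t * b \<in> J" by (rule adjE)
  then have *: "hcomp d p - hcomp d (t * b) \<in> J"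
    using assms(1) unfolding homog_ideal_def by (metis hcomp_diff)
  show "hcomp d p \<in> adj J t"
  proof (cases "d < e")
    case True
    then show ?thesis
      using * hcomp_mult_homog_low[OF assms(2)] subset_adj[of J t] by auto
  next
    case False
    then show ?thesis
      using * hcomp_mult_homog[OF assms(2), of "d - e" b] by (auto intro: adjI)
  qed
qed

lemma homog_ideal_foldl_adj:
  assumes "homog_ideal J" "idl J" "\<forall>t\<in>set ts. \<exists>e. homog e t"
  shows "homog_ideal (foldl adj J ts)"
  using assms by (induction ts arbitrary: J) (auto intro: idl_adj homog_ideal_adj)

lemma idl_foldl_adj: "idl J \<Longrightarrow> idl (foldl adj J ts)"
  by (induction ts arbitrary: J) (auto intro: idl_adj)

lemma subset_foldl_adj: "J \<subseteq> foldl adj J ts"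
  by (induction ts arbitrary: J) (use subset_adj in fastforce)+

text \<open>A graded form of Krull intersection: modulo \<open>J\<close>, the component of degree
  \<open>d\<close> of \<open>g\<close> agrees with that of a multiple of \<open>x ^ Suc d\<close>,
  which has none. It provides the separation hypothesis of \<open>wreg_swap\<close>.\<close>

lemma homog_ideal_separated:
  assumes "homog_ideal J" "idl J" "\<And>k. homog k (x ^ k)" "\<And>k. g \<in> adj J (x ^ k)"
  shows "g \<in> J"
proof -
  have "hcomp d g \<in> J" for d
  proof -
    obtain b where "g - x ^ Suc d * b \<in> J" using assms(4)[of "Suc d"] by (rule adjE)
    then have "hcomp d g - hcomp d (x ^ Suc d * b) \<in> J"
      using assms(1) unfolding homog_ideal_def by (metis hcomp_diff)
    then show ?thesis using hcomp_mult_homog_low[OF assms(3)[of "Suc d"], of d b] by simp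
  qed
  then show ?thesis by (subst sum_hcomp) (intro idl_sum[OF assms(2)])
qed

section \<open>Elementary symmetric polynomials as a universal regular sequence\<close>

definition sqfree :: "'n set \<Rightarrow> 'n expo"
  where "sqfree A = (\<Sum>i\<in>A. Poly_Mapping.single i 1)"

definition esym :: "nat \<Rightarrow> ('n::finite, 'k::field) mpoly"
  where "esym j = (\<Sum>A | card A = j. xpow (sqfree A))"

text \<open>The exponents of the monomials in the ideal \<open>(x\<^sub>i : i \<notin> A)\<close>.\<close>

definition dead :: "'n set \<Rightarrow> 'n expo set"
  where "dead A = {m. \<exists>i. i \<notin> A \<and> 0 < Poly_Mapping.lookup m i}"

lemma lookup_sqfree: "Poly_Mapping.lookup (sqfree A) i = (if i \<in> A then 1 else 0)"
  for A :: "'n::finite set"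
  by (simp add: sqfree_def lookup_sum lookup_single when_def)

lemma expo_degree_sqfree: "expo_degree (sqfree A) = card A" for A :: "'n::finite set"
  by (simp add: expo_degree_def lookup_sqfree sum.If_cases)

lemma esym_homog: "homog j (esym j :: ('n::finite, 'k::field) mpoly)"
proof -
  have "Poly_Mapping.keys (esym j :: ('n, 'k) mpoly) \<subseteq> (\<Union>A\<in>{A. card A = j}. {sqfree A})"
    unfolding esym_def by (rule order_trans[OF Poly_Mapping.keys_sum]) simp
  then show ?thesis by (auto simp: homog_def expo_degree_sqfree)
qed

lemma esym_in_max_ideal: "0 < j \<Longrightarrow> esym j \<in> (max_ideal :: ('n::finite, 'k::field) mpoly set)"
proof -
  assume "0 < j"
  moreover have "homog j (esym j :: ('n, 'k) mpoly)" by (rule esym_homog)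
  ultimately show ?thesis by (auto simp: max_ideal_eq monspan_def homog_def)
qed

lemma upclosed_dead: "upclosed (dead A)"
  by (auto simp: upclosed_def dead_def lookup_add)

lemma dead_Un_up: "i \<in> A \<Longrightarrow> dead A \<union> up {Poly_Mapping.single i 1} = dead (A - {i})"
proof (intro equalityI subsetI)
  fix m assume "i \<in> A" "m \<in> dead (A - {i})"
  then show "m \<in> dead A \<union> up {Poly_Mapping.single i 1}"
    using expo_split_single[of m i] upI[of "Poly_Mapping.single i 1" _ "m - Poly_Mapping.single i 1"]
    by (auto simp: dead_def add.commute)
next
  fix m assume "i \<in> A" "m \<in> dead A \<union> up {Poly_Mapping.single i 1}"
  then show "m \<in> dead (A - {i})"
    unfolding dead_def up_def by (auto simp: lookup_add intro: exI[of _ i])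
qed

text \<open>Every other set of the same size leaves \<open>A\<close>, so its monomial contains a
  variable outside \<open>A\<close>.\<close>

lemma esym_cong_dead:
  fixes A :: "'n::finite set"
  shows "(esym (card A) :: ('n, 'k::field) mpoly) - xpow (sqfree A) \<in> monspan (dead A)"
proof -
  have "(esym (card A) :: ('n, 'k) mpoly) =
      xpow (sqfree A) + (\<Sum>B\<in>{B. card B = card A} - {A}. xpow (sqfree B))"
    unfolding esym_def by (rule sum.remove) auto
  moreover have "(\<Sum>B\<in>{B. card B = card A} - {A}. xpow (sqfree B) :: ('n, 'k) mpoly) \<in> monspan (dead A)"
  proof (rule idl_sum[OF idl_monspan[OF upclosed_dead]])
    fix B assume "B \<in> {B. card B = card A} - {A}"
    then have "\<not> B \<subseteq> A" using card_subset_eq[of A B] by auto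
    then show "xpow (sqfree B) \<in> (monspan (dead A) :: ('n, 'k) mpoly set)"
      by (auto simp: dead_def lookup_sqfree)
  qed
  ultimately show ?thesis by simp
qed

lemma var_regular_dead:
  assumes "i \<in> A" "var i * g \<in> (monspan (dead A) :: ('n, 'k::field) mpoly set)"
  shows "g \<in> monspan (dead A)"
proof -
  have "g * xpow (Poly_Mapping.single i 1) \<in> (monspan (dead A) :: ('n, 'k::field) mpoly set)"
    using assms(2) by (simp add: var_def mult.commute)
  then have "g \<in> monspan {m. m + Poly_Mapping.single i 1 \<in> dead A}"
    using monspan_colon by blast
  moreover have "{m. m + Poly_Mapping.single i 1 \<in> dead A} \<subseteq> dead A"
    using assms(1) by (auto simp: dead_def lookup_add lookup_single when_def split: if_splits)
  ultimately show ?thesis unfolding monspan_def by blast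
qed

lemma var_power_homog: "homog k (var i ^ k :: ('n::finite, 'k::field) mpoly)"
proof (induction k)
  case (Suc k)
  have "homog 1 (var i :: ('n, 'k) mpoly)" by (simp add: homog_def var_def)
  from homog_mult[OF this Suc] show ?case by simp
qed (simp add: homog_def)

text \<open>Setting all but \<open>s\<close> variables to zero turns the \<open>s\<close>-th elementary symmetric polynomial into
  the product of the remaining ones.\<close>

lemma esym_wreg:
  fixes A :: "'n::finite set"
  assumes "s \<le> card A"
  shows "wreg (monspan (dead A)) (map (esym :: nat \<Rightarrow> ('n, 'k::field) mpoly) [1..<Suc s])"
  using assms
proof (induction "card A" arbitrary: A s rule: less_induct)
  case less
  let ?J = "monspan (dead A) :: ('n, 'k) mpoly set"
  let ?e = "\<lambda>s. map (esym :: nat \<Rightarrow> ('n, 'k) mpoly) [1..<Suc s]"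
  have J: "idl ?J" by (rule idl_monspan[OF upclosed_dead])
  \<comment> \<open>The induction hypothesis concerns the ring with \<open>x_i\<close> set to zero.
    Exchanging \<open>x_i\<close> with the sequence makes the sequence regular before that, and
    \<open>x_i\<close> regular after it.\<close>
  have swap: "wreg ?J (?e r) \<and> (\<forall>g. var i * g \<in> foldl adj ?J (?e r) \<longrightarrow> g \<in> foldl adj ?J (?e r))"
    if i: "i \<in> A" and r: "Suc r \<le> card A" for i r
  proof (rule wreg_swap[OF J])
    have "card (A - {i}) < card A" "r \<le> card (A - {i})" using i r by (auto simp: card_gt_0_iff)
    then have "wreg (monspan (dead (A - {i}))) (?e r)" using less.hyps by blast
    then show "wreg (adj ?J (var i)) (?e r)"
      unfolding var_def monspan_adj[OF upclosed_dead] dead_Un_up[OF i] .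
  next
    fix k g assume g: "\<And>k'. g \<in> adj (foldl adj ?J (take k (?e r))) (var i ^ k')"
    have "homog_ideal (foldl adj ?J (take k (?e r)))"
      by (intro homog_ideal_foldl_adj J homog_ideal_monspan)
         (auto dest!: in_set_takeD intro: exI[of "\<lambda>e. homog e (esym _)", OF esym_homog])
    then show "g \<in> foldl adj ?J (take k (?e r))"
      by (rule homog_ideal_separated[OF _ idl_foldl_adj[OF J] var_power_homog g])
  qed (rule var_regular_dead[OF i])
  show ?case
  proof (cases s)
    case 0
    then show ?thesis by simp
  next
    case (Suc s')
    then obtain i where i: "i \<in> A" using less.prems by fastforce
    show ?thesis
    proof (cases "s < card A")
      case True
      then show ?thesis using swap[OF i, of s, THEN conjunct1] by simp
    next
      case False
      then have s: "card A = Suc s'" using Suc less.prems by simp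
      let ?J' = "foldl adj ?J (?e s')"
      have J': "idl ?J'" by (rule idl_foldl_adj[OF J])
      \<comment> \<open>Only the polynomial of degree \<open>card A\<close> is left. It is congruent
        to the product of the variables in \<open>A\<close>, and \<open>swap\<close> makes each of
        these regular modulo the earlier ones.\<close>
      have var: "g \<in> ?J'" if "i \<in> A" "var i * g \<in> ?J'" for i g
        using swap[of i s'] that s by simp
      have prod: "xpow (sqfree B) * g \<in> ?J' \<Longrightarrow> g \<in> ?J'" if "B \<subseteq> A" for B g
        using finite[of B] that
      proof (induction B arbitrary: g rule: finite_induct)
        case empty
        then show ?case by (simp add: sqfree_def xpow_def)
      next
        case (insert j B)
        have "xpow (sqfree (insert j B)) * g = var j * (xpow (sqfree B) * g)"
          using insert.hyps by (simp add: sqfree_def xpow_add var_def mult.assoc)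
        with insert show ?case using var by (metis insert_subset)
      qed
      have "g \<in> ?J'" if g: "esym s * g \<in> ?J'" for g
      proof (rule prod[OF subset_refl])
        have "esym s - xpow (sqfree A) \<in> ?J'"
          using esym_cong_dead[of A] Suc s subset_foldl_adj by (metis subsetD)
        then have "esym s * g - xpow (sqfree A) * g \<in> ?J'"
          unfolding left_diff_distrib[symmetric] by (rule idl_mult_right[OF J'])
        then show "xpow (sqfree A) * g \<in> ?J'" using g idl_cong[OF J'] by blast
      qed
      then have "wreg ?J' [esym s]" unfolding wreg.simps by blast
      then have "wreg ?J (?e s' @ [esym s])" 
        using swap[OF i, of s', THEN conjunct1] s unfolding wreg_append by simp
      then show ?thesis using Suc by simp
    qed
  qed
qed

section \<open>A lower bound for the depth\<close>

lemma exch_eq: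
  assumes "0 < Poly_Mapping.lookup l m"
  shows "exch l i m = (l - Poly_Mapping.single m 1) + Poly_Mapping.single i 1"
  using assms unfolding exch_def
  by (intro poly_mapping_eqI) (auto simp: lookup_add lookup_minus lookup_single when_def)

lemma lookup_exch:
  assumes "0 < Poly_Mapping.lookup l m" "i \<noteq> m"
  shows "Poly_Mapping.lookup (exch l i m) j =
    (if j = i then Suc (Poly_Mapping.lookup l i) else if j = m then Poly_Mapping.lookup l m - 1
     else Poly_Mapping.lookup l j)"
  using assms unfolding exch_def by (auto simp: lookup_add lookup_minus lookup_single when_def)

lemma expo_degree_mono:
  "(\<And>i. Poly_Mapping.lookup a i \<le> Poly_Mapping.lookup b i) \<Longrightarrow> expo_degree a \<le> expo_degree b"
  unfolding expo_degree_def by (rule sum_mono)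

lemma expo_degree_exch:
  assumes "0 < Poly_Mapping.lookup l m"
  shows "expo_degree (exch l i m) = expo_degree l"
  using exch_eq[OF assms, of i] expo_split_single[OF assms]
  by (metis expo_degree_add expo_degree_single)

text \<open>The depth of \<open>R/(x\<^sup>l : l \<in> L)\<close>, where all elements of \<open>L\<close> are bounded by \<open>c\<close> and lie \<open>D\<close> degrees
  below it, is handled by splitting off \<open>R/(J : x\<^sub>i)\<close> and \<open>R/(J + (x\<^sub>i))\<close>. Both are of the same shape,
  with \<open>c\<^sub>i\<close> lowered by one, respectively with \<open>x\<^sub>i\<close> removed from the set \<open>A\<close> of surviving variables.\<close>

lemma esym_wreg_closed:
  fixes L :: "'n::finite expo set"
  assumes "\<And>l i. l \<in> L \<Longrightarrow> Poly_Mapping.lookup l i \<le> Poly_Mapping.lookup c i"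
    and "\<And>l. l \<in> L \<Longrightarrow> expo_degree l + D = expo_degree c"
    and "\<And>l i m. l \<in> L \<Longrightarrow> Poly_Mapping.lookup l i < Poly_Mapping.lookup c i \<Longrightarrow>
      Poly_Mapping.lookup l m = Poly_Mapping.lookup c m \<Longrightarrow> 0 < Poly_Mapping.lookup c m \<Longrightarrow> exch l i m \<in> L"
    and "D \<le> card (Poly_Mapping.keys c)" "Poly_Mapping.keys c \<subseteq> A" "s + 1 + D \<le> card A"
  shows "wreg (monspan (up L \<union> dead A)) (map (esym :: nat \<Rightarrow> ('n, 'k::field) mpoly) [1..<Suc s])"
  using assms
proof (induction "expo_degree c" arbitrary: c L A D rule: less_induct)
  case less
  note le = less.prems(1) and deg = less.prems(2) and cl = less.prems(3)
    and D = less.prems(4) and A = less.prems(5) and s = less.prems(6)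
  have card_le_deg: "card (Poly_Mapping.keys c) \<le> expo_degree c"
  proof -
    have "card (Poly_Mapping.keys c) = (\<Sum>i\<in>Poly_Mapping.keys c. 1)" by simp
    also have "\<dots> \<le> (\<Sum>i\<in>Poly_Mapping.keys c. Poly_Mapping.lookup c i)"
      by (rule sum_mono) (simp add: in_keys_iff Suc_le_eq)
    also have "\<dots> \<le> expo_degree c" unfolding expo_degree_def by (rule sum_mono2) auto
    finally show ?thesis .
  qed
  show ?case
  proof (cases "(\<forall>i. Poly_Mapping.lookup c i \<le> 1) \<and> card (Poly_Mapping.keys c) = D")
    case True
    \<comment> \<open>Now \<open>c\<close> is squarefree of degree \<open>D\<close>, so elements of
      \<open>L\<close> have degree zero.\<close>
    have "Poly_Mapping.lookup c i = (if i \<in> Poly_Mapping.keys c then 1 else 0)" for i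
      using True[THEN conjunct1, rule_format, of i] by (auto simp: in_keys_iff)
    then have "expo_degree c = D" using True by (simp add: expo_degree_def sum.If_cases)
    then have "L \<subseteq> {0}" using deg by (auto simp flip: expo_degree_eq_0)
    then consider "L = {}" | "L = {0}" by blast
    then show ?thesis
    proof cases
      case 1
      then have "up L = {}" by (simp add: up_def)
      moreover have "s \<le> card A" using s by simp
      ultimately show ?thesis using esym_wreg by (metis Un_empty_left)
    next
      case 2
      then have "monspan (up L \<union> dead A) = (UNIV :: ('n, 'k) mpoly set)"
        by (simp add: up_zero monspan_def)
      then show ?thesis by (simp only: wreg_UNIV)
    qed
  next
    case False
    \<comment> \<open>Lowering \<open>c\<close> at \<open>i\<close> must preserve the bound of
      \<open>D\<close> by the size of the support: either \<open>i\<close> stays in the support or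
      the bound is strict. The same alternative drives the count in \<open>full\<close>.\<close>
    have "\<exists>i. i \<in> Poly_Mapping.keys c \<and> (2 \<le> Poly_Mapping.lookup c i \<or> D < card (Poly_Mapping.keys c))"
    proof (cases "\<forall>i. Poly_Mapping.lookup c i \<le> 1")
      case True
      then have "D < card (Poly_Mapping.keys c)" using False D by simp
      then show ?thesis by (metis card.empty equals0I not_less_zero)
    next
      case False
      then obtain j where "2 \<le> Poly_Mapping.lookup c j" by (auto simp: not_le Suc_le_eq numeral_2_eq_2)
      then show ?thesis by (intro exI[of _ j]) (auto simp: in_keys_iff)
    qed
    then obtain i where i: "i \<in> Poly_Mapping.keys c"
      and i2: "2 \<le> Poly_Mapping.lookup c i \<or> D < card (Poly_Mapping.keys c)" by blast
    have iA: "i \<in> A" using i A by blast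
    have ci: "0 < Poly_Mapping.lookup c i" using i by (simp add: in_keys_iff)
    let ?u = "Poly_Mapping.single i 1 :: 'n expo"
    let ?J = "monspan (up L \<union> dead A) :: ('n, 'k) mpoly set"
    have up_J: "upclosed (up L \<union> dead A)" by (intro upclosed_Un upclosed_up upclosed_dead)
    define L1 where "L1 = {l. l + ?u \<in> L}"
    define c1 where "c1 = c - ?u"
    have c: "c = c1 + ?u" unfolding c1_def by (rule expo_split_single[OF ci])
    \<comment> \<open>Otherwise \<open>l\<close> falls short of \<open>c\<close> by
      \<open>c i\<close> at \<open>i\<close> and by at least 1 at every other key; by the choice of
      \<open>i\<close> this exceeds \<open>D\<close>.\<close>
    have full: "\<exists>m. m \<noteq> i \<and> Poly_Mapping.lookup l m = Poly_Mapping.lookup c m \<and> 0 < Poly_Mapping.lookup c m"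
      if l: "l \<in> L" "Poly_Mapping.lookup l i = 0" for l
    proof (rule ccontr)
      assume "\<not> ?thesis"
      then have lt: "Poly_Mapping.lookup l m < Poly_Mapping.lookup c m"
        if "m \<in> Poly_Mapping.keys c" "m \<noteq> i" for m
        using that le[OF l(1), of m] by (auto simp: in_keys_iff le_less)
      define K where "K = Poly_Mapping.keys c - {i}"
      have "(\<Sum>j\<in>UNIV. Poly_Mapping.lookup l j + (if j = i then Poly_Mapping.lookup c i else if j \<in> K then 1 else 0))
          \<le> (\<Sum>j\<in>UNIV. Poly_Mapping.lookup c j)"
        using lt l(2) le[OF l(1)] by (intro sum_mono) (auto simp: K_def Suc_le_eq)
      moreover have "(\<Sum>j\<in>UNIV. if j = i then Poly_Mapping.lookup c i else if j \<in> K then 1 else 0) =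
          Poly_Mapping.lookup c i + card K"
      proof -
        have "(\<Sum>j\<in>UNIV. if j = i then Poly_Mapping.lookup c i else if j \<in> K then 1 else 0) =
            (\<Sum>j\<in>UNIV. (if j = i then Poly_Mapping.lookup c i else 0) + (if j \<in> K then 1 else 0))"
          by (rule sum.cong) (auto simp: K_def)
        also have "\<dots> = Poly_Mapping.lookup c i + card K" by (simp add: sum.distrib sum.If_cases)
        finally show ?thesis .
      qed
      ultimately have "expo_degree l + (Poly_Mapping.lookup c i + card K) \<le> expo_degree c"
        by (simp add: expo_degree_def sum.distrib)
      then have "Poly_Mapping.lookup c i + card K \<le> D" using deg[OF l(1)] by simp
      moreover have "card (Poly_Mapping.keys c) = Suc (card K)"
        unfolding K_def using card_Suc_Diff1[OF _ i] by simp
      ultimately show False using i2 D ci by auto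
    qed
    have "{m. m + ?u \<in> up L \<union> dead A} = up L1 \<union> dead A"
    proof (intro equalityI subsetI)
      fix m assume "m \<in> {m. m + ?u \<in> up L \<union> dead A}"
      then consider "m + ?u \<in> dead A" | "m + ?u \<in> up L" by blast
      then show "m \<in> up L1 \<union> dead A"
      proof cases
        case 1
        then show ?thesis
          using iA by (auto simp: dead_def lookup_add lookup_single when_def split: if_splits)
      next
        case 2
        then obtain l b where l: "l \<in> L" "m + ?u = l + b" unfolding up_def by blast
        show ?thesis
        proof (cases "Poly_Mapping.lookup l i")
          case (Suc k)
          then have "l = (l - ?u) + ?u" by (intro expo_split_single) simp
          then have "l - ?u \<in> L1" "m = (l - ?u) + b" using l unfolding L1_def
            by (simp, metis (no_types, lifting) add.assoc add.commute add_right_cancel)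
          then show ?thesis using upI by blast
        next
          case 0
          then obtain j where j: "j \<noteq> i" "Poly_Mapping.lookup l j = Poly_Mapping.lookup c j"
            "0 < Poly_Mapping.lookup c j" using full l(1) by blast
          \<comment> \<open>A generator without \<open>x_i\<close> is a multiple of an element of
            \<open>L1\<close>: exchanging a full entry \<open>j\<close> for \<open>i\<close> shows
            that x^l/x_j is one. So \<open>L1\<close> suffices to generate the colon ideal modulo
            the dead variables.\<close>
          then have "exch l i j \<in> L" using cl[OF l(1)] 0 ci by simp
          then have "l - Poly_Mapping.single j 1 \<in> L1"
            using exch_eq[of l j i] j by (simp add: L1_def)
          moreover have "m = (l - Poly_Mapping.single j 1) + (Poly_Mapping.single j 1 + (b - ?u))"
          proof -
            have "Poly_Mapping.lookup (m + ?u) i = Poly_Mapping.lookup (l + b) i" using l(2) by simp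
            then have "0 < Poly_Mapping.lookup b i" using 0 by (simp add: lookup_add)
            then have "b = (b - ?u) + ?u" by (rule expo_split_single)
            moreover have "l = (l - Poly_Mapping.single j 1) + Poly_Mapping.single j 1"
              using j by (intro expo_split_single) simp
            ultimately show ?thesis
              using l(2) by (metis (no_types, lifting) add.assoc add_right_cancel)
          qed
          ultimately show ?thesis using upI by blast
        qed
      qed
    next
      fix m assume "m \<in> up L1 \<union> dead A"
      then consider "m \<in> up L1" | "m \<in> dead A" by blast
      then show "m \<in> {m. m + ?u \<in> up L \<union> dead A}"
      proof cases
        case 1
        then obtain l b where "m = l + b" "l + ?u \<in> L" unfolding up_def L1_def by blast
        then have "m + ?u = (l + ?u) + b" by (simp add: add_ac)
        then show ?thesis using upI[OF \<open>l + ?u \<in> L\<close>] by simp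
      next
        case 2
        then show ?thesis by (auto simp: dead_def lookup_add)
      qed
    qed
    then have colon: "{a. a * xpow ?u \<in> ?J} = monspan (up L1 \<union> dead A)"
      unfolding monspan_colon by simp
    have keys_c1: "Poly_Mapping.keys c1 \<subseteq> Poly_Mapping.keys c" "Poly_Mapping.keys c - {i} \<subseteq> Poly_Mapping.keys c1"
      "2 \<le> Poly_Mapping.lookup c i \<Longrightarrow> Poly_Mapping.keys c \<subseteq> Poly_Mapping.keys c1"
      unfolding c1_def by (auto simp: in_keys_iff lookup_minus lookup_single when_def split: if_splits)
    have card_c1: "D \<le> card (Poly_Mapping.keys c1)"
    proof (cases "2 \<le> Poly_Mapping.lookup c i")
      case True
      then show ?thesis using D card_mono[OF _ keys_c1(3)] by fastforce
    next
      case False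
      have "card (Poly_Mapping.keys c) - 1 \<le> card (Poly_Mapping.keys c1)"
        using card_mono[OF _ keys_c1(2)] i by simp
      then show ?thesis using False i2 by simp
    qed
    have wreg1: "wreg {a. a * xpow ?u \<in> ?J} (map (esym :: nat \<Rightarrow> ('n, 'k) mpoly) [1..<Suc s])"
      unfolding colon
    proof (rule less.hyps[of c1 L1 D A])
      show "expo_degree c1 < expo_degree c" using expo_degree_add[of c1 ?u] unfolding c[symmetric] by simp
      show "D \<le> card (Poly_Mapping.keys c1)" by (rule card_c1)
      show "Poly_Mapping.keys c1 \<subseteq> A" using keys_c1(1) A by blast
      show "s + 1 + D \<le> card A" by (rule s)
      fix l assume "l \<in> L1"
      then have l: "l + ?u \<in> L" by (simp add: L1_def)
      show "Poly_Mapping.lookup l j \<le> Poly_Mapping.lookup c1 j" for j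
        using le[OF l, of j] unfolding c by (simp add: lookup_add)
      show "expo_degree l + D = expo_degree c1"
        using deg[OF l] unfolding c by (simp add: expo_degree_add)
      fix j m assume jm: "Poly_Mapping.lookup l j < Poly_Mapping.lookup c1 j"
        "Poly_Mapping.lookup l m = Poly_Mapping.lookup c1 m" "0 < Poly_Mapping.lookup c1 m"
      then have "exch (l + ?u) j m \<in> L" by (intro cl[OF l]) (simp_all add: c lookup_add)
      moreover have "exch (l + ?u) j m = exch l j m + ?u"
        using jm unfolding exch_def
        by (intro poly_mapping_eqI) (auto simp: lookup_add lookup_minus lookup_single when_def)
      ultimately show "exch l j m \<in> L1" by (simp add: L1_def)
    qed
    define L0 where "L0 = {l \<in> L. Poly_Mapping.lookup l i = 0}"
    define c0 where "c0 = c - Poly_Mapping.single i (Poly_Mapping.lookup c i)"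
    have c0: "c = c0 + Poly_Mapping.single i (Poly_Mapping.lookup c i)"
      unfolding c0_def by (rule poly_mapping_eqI) (simp add: lookup_add lookup_minus lookup_single when_def)
    have lookup_c0: "Poly_Mapping.lookup c0 j = (if j = i then 0 else Poly_Mapping.lookup c j)" for j
      unfolding c0_def by (simp add: lookup_minus lookup_single when_def)
    have "up L \<union> dead A \<union> up {?u} = up L0 \<union> dead (A - {i})"
    proof -
      have "up L \<subseteq> up L0 \<union> dead (A - {i})"
      proof
        fix m assume "m \<in> up L"
        then obtain l b where m: "m = l + b" "l \<in> L" unfolding up_def by blast
        show "m \<in> up L0 \<union> dead (A - {i})"
        proof (cases "Poly_Mapping.lookup l i = 0")
          case True
          then have "l \<in> L0" using m by (simp add: L0_def)
          then show ?thesis using m upI by blast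
        next
          case False
          then show ?thesis using m by (auto simp: dead_def lookup_add intro!: exI[of _ i])
        qed
      qed
      moreover have "up L0 \<subseteq> up L" unfolding up_def L0_def by blast
      ultimately show ?thesis using dead_Un_up[OF iA] by blast
    qed
    then have adj: "adj ?J (xpow ?u) = monspan (up L0 \<union> dead (A - {i}))"
      unfolding monspan_adj[OF up_J] by simp
    have cardA: "card (A - {i}) = card A - 1" using iA by simp
    have wreg0: "wreg (adj ?J (xpow ?u)) (map (esym :: nat \<Rightarrow> ('n, 'k) mpoly) [1..<Suc s])"
    \<comment> \<open>If every generator involves \<open>x_i\<close>, the quotient is a polynomial
      ring in \<open>A - {i}\<close>; the summand 1 in \<open>s + 1 + D \<le> card A\<close> pays
      for the lost variable.\<close>
    proof (cases "L0 = {}")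
      case True
      then have "up L0 = {}" by (simp add: up_def)
      moreover have "s \<le> card (A - {i})" using s cardA by simp
      ultimately show ?thesis unfolding adj using esym_wreg by (metis Un_empty_left)
    next
      case False
      have deg0: "expo_degree c = expo_degree c0 + Poly_Mapping.lookup c i"
        by (subst c0) (simp only: expo_degree_add expo_degree_single)
      have le0: "Poly_Mapping.lookup l j \<le> Poly_Mapping.lookup c0 j" if "l \<in> L0" for l j
        using that le[of l j] by (auto simp: L0_def lookup_c0)
      \<comment> \<open>An element vanishing at \<open>i\<close> already spends \<open>c i\<close>
        of its defect \<open>D\<close> there. This drop of at least 1 in the defect compensates the
        loss of \<open>i\<close> from \<open>A\<close>.\<close>
      have ciD: "Poly_Mapping.lookup c i \<le> D"
      proof -
        obtain l where l: "l \<in> L0" using False by blast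
        then have "expo_degree l \<le> expo_degree c0" by (intro expo_degree_mono le0)
        moreover have "expo_degree l + D = expo_degree c" using l deg by (simp add: L0_def)
        ultimately show ?thesis using deg0 by simp
      qed
      show ?thesis
        unfolding adj
      proof (rule less.hyps[of c0 L0 "D - Poly_Mapping.lookup c i" "A - {i}"])
        show "expo_degree c0 < expo_degree c" using deg0 ci by simp
        have "Poly_Mapping.keys c0 = Poly_Mapping.keys c - {i}"
          by (auto simp: in_keys_iff lookup_c0 split: if_splits)
        then show "D - Poly_Mapping.lookup c i \<le> card (Poly_Mapping.keys c0)"
          "Poly_Mapping.keys c0 \<subseteq> A - {i}"
          using D i ci A by auto
        show "s + 1 + (D - Poly_Mapping.lookup c i) \<le> card (A - {i})"
          using s ciD ci cardA by simp
        fix l assume l: "l \<in> L0"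
        show "Poly_Mapping.lookup l j \<le> Poly_Mapping.lookup c0 j" for j by (rule le0[OF l])
        show "expo_degree l + (D - Poly_Mapping.lookup c i) = expo_degree c0"
          using deg[of l] l deg0 ciD by (simp add: L0_def)
        fix j m assume jm: "Poly_Mapping.lookup l j < Poly_Mapping.lookup c0 j"
          "Poly_Mapping.lookup l m = Poly_Mapping.lookup c0 m" "0 < Poly_Mapping.lookup c0 m"
        then have ne: "j \<noteq> i" "m \<noteq> i" "j \<noteq> m" by (auto simp: lookup_c0)
        then have "exch l j m \<in> L" using jm l by (intro cl) (auto simp: lookup_c0 L0_def)
        moreover have "Poly_Mapping.lookup (exch l j m) i = 0"
          using ne l jm by (subst lookup_exch) (auto simp: L0_def)
        ultimately show "exch l j m \<in> L0" by (simp add: L0_def)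
      qed
    qed
    show ?thesis
      by (rule wreg_colon_adj[OF idl_monspan[OF up_J] wreg1 wreg0])
  qed
qed

section \<open>Powers of shifted sets of exponents\<close>

text \<open>The maximal entry may stand at any position instead of the last one of a sorted
  exponent, which frees the combinatorics of exponents from permutations.\<close>

definition shifted_exps :: "'n expo set \<Rightarrow> bool"
  where "shifted_exps S \<longleftrightarrow> (\<forall>l\<in>S. \<forall>i m. (\<forall>j. Poly_Mapping.lookup l j \<le> Poly_Mapping.lookup l m) \<and>
    Poly_Mapping.lookup l i < Poly_Mapping.lookup l m \<longrightarrow> exch l i m \<in> S)"

lemma lookup_const_expo [simp]: "Poly_Mapping.lookup (const_expo a) i = a"
  by (simp add: const_expo_def lookup_sum lookup_single when_def)

lemma expo_degree_const_expo: "expo_degree (const_expo a :: 'n::finite expo) = CARD('n) * a"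
  by (simp add: expo_degree_def)

lemma expo_eq_const_expo:
  fixes l :: "'n::finite expo"
  assumes "CARD('n) = 1"
  shows "l = const_expo (expo_degree l)"
proof (rule poly_mapping_eqI)
  fix i :: 'n
  obtain x :: 'n where x: "UNIV = {x}" using assms by (rule card_1_singletonE)
  then have "i = x" by blast
  then show "Poly_Mapping.lookup l i = Poly_Mapping.lookup (const_expo (expo_degree l)) i"
    by (simp add: expo_degree_def x)
qed

lemma exch_add: "0 < Poly_Mapping.lookup b m \<Longrightarrow> exch (a + b) i m = a + exch b i m"
  unfolding exch_def
  by (rule poly_mapping_eqI) (auto simp: lookup_add lookup_minus lookup_single when_def)

lemma sumpow_degree:
  assumes "\<And>l. l \<in> S \<Longrightarrow> expo_degree l = d" "l \<in> sumpow S k"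
  shows "expo_degree l = k * d"
  using assms(2) by (induction k arbitrary: l) (auto simp: expo_degree_add assms(1))

lemma sumpow_nonempty: "S \<noteq> {} \<Longrightarrow> sumpow S k \<noteq> {}"
  by (induction k) auto

lemma up_degree_ge:
  "(\<And>l. l \<in> S \<Longrightarrow> expo_degree l = d) \<Longrightarrow> a \<in> up S \<Longrightarrow> d \<le> expo_degree a"
  by (auto simp: up_def expo_degree_add)

lemma sumpow_bound:
  assumes "\<And>l i. l \<in> S \<Longrightarrow> Poly_Mapping.lookup l i \<le> c" "l \<in> sumpow S k"
  shows "Poly_Mapping.lookup l i \<le> k * c"
  using assms(2)
proof (induction k arbitrary: l)
  case (Suc k)
  then obtain a b where "l = a + b" "a \<in> sumpow S k" "b \<in> S" by auto
  then show ?case using Suc.IH[of a] assms(1)[of b i] by (simp add: lookup_add)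
qed simp

text \<open>Products of shifted ideals need not be treated in general: an entry of a sum can only attain the
  bound \<open>k * c\<close> if the entries of all summands attain \<open>c\<close>, so one of the summands can be shifted.\<close>

lemma sumpow_exch:
  assumes "shifted_exps S" "\<And>l i. l \<in> S \<Longrightarrow> Poly_Mapping.lookup l i \<le> c"
    and "l \<in> sumpow S k" "Poly_Mapping.lookup l m = k * c" "Poly_Mapping.lookup l i < k * c"
  shows "exch l i m \<in> sumpow S k"
  using assms(3-5)
proof (induction k arbitrary: l)
  case (Suc k)
  then obtain a b where l: "l = a + b" "a \<in> sumpow S k" "b \<in> S" by auto
  have "Poly_Mapping.lookup a m \<le> k * c" "Poly_Mapping.lookup b m \<le> c"
    using sumpow_bound[OF assms(2) l(2)] assms(2)[OF l(3)] by auto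
  then have m: "Poly_Mapping.lookup a m = k * c" "Poly_Mapping.lookup b m = c"
    using Suc.prems(2) l(1) by (auto simp: lookup_add)
  show ?case
  proof (cases "Poly_Mapping.lookup b i < c")
    case True
    then have "exch b i m \<in> S" using assms(1,2) l(3) m(2) unfolding shifted_exps_def by metis
    moreover have "exch l i m = a + exch b i m"
      using True m unfolding l(1) by (intro exch_add) simp
    ultimately show ?thesis using l(2) by auto
  next
    case False
    then have lt: "Poly_Mapping.lookup a i < k * c"
      using Suc.prems(3) l(1) by (simp add: lookup_add)
    then have "exch a i m \<in> sumpow S k" by (intro Suc.IH l(2) m(1))
    moreover have "exch l i m = exch a i m + b"
    proof -
      have "0 < Poly_Mapping.lookup a m" using lt m by linarith
      from exch_add[OF this, of b i] show ?thesis unfolding l(1) by (simp add: add.commute)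
    qed
    ultimately show ?thesis using l(3) by auto
  qed
qed simp

text \<open>A shift from an entry \<open>c\<close> to an entry \<open>c - 1\<close> just swaps the
  two. Each swap brings the set of lowered positions closer to \<open>B'\<close>.\<close>

lemma shifted_sqfree_complement:
  fixes S :: "'n::finite expo set"
  assumes "shifted_exps S" "0 < c" "const_expo c - sqfree B \<in> S" "card B' = card B"
  shows "const_expo c - sqfree B' \<in> S"
  using assms(3,4)
proof (induction "card (B' - B)" arbitrary: B)
  case 0
  then have "B' = B" using card_subset_eq[of B B'] by auto
  then show ?case using 0 by simp
next
  case (Suc k)
  then obtain m where m: "m \<in> B'" "m \<notin> B" by (metis DiffD1 DiffD2 card.empty equals0I nat.distinct(1))
  have "\<not> B \<subseteq> B'" using Suc.prems(2) card_subset_eq[of B' B] m by auto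
  then obtain i where i: "i \<in> B" "i \<notin> B'" by blast
  define B2 where "B2 = insert m (B - {i})"
  have "exch (const_expo c - sqfree B) i m \<in> S"
    using assms(1) Suc.prems(1) i m assms(2) unfolding shifted_exps_def
    by (auto simp: lookup_minus lookup_sqfree)
  moreover have "exch (const_expo c - sqfree B) i m = const_expo c - sqfree B2"
    using i m assms(2) unfolding exch_def B2_def
    by (intro poly_mapping_eqI) (auto simp: lookup_add lookup_minus lookup_single when_def lookup_sqfree)
  moreover have "card B' = card B2"
    using i m Suc.prems(2) by (simp add: B2_def card_Diff_singleton_if card_gt_0_iff) (metis card_gt_0_iff empty_iff finite Suc_pred)
  moreover have "k = card (B' - B2)"
  proof -
    have "B' - B = insert m (B' - B2)" "m \<notin> B' - B2" using m i by (auto simp: B2_def)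
    then show ?thesis using Suc.hyps(2) by simp
  qed
  ultimately show ?case using Suc.hyps(1) by simp
qed

lemma shifted_exps_cases:
  fixes S :: "'n::finite expo set"
  assumes "shifted_exps S" "S \<noteq> {}" "\<And>l. l \<in> S \<Longrightarrow> expo_degree l = d" "0 < d"
  obtains (unique_max) l m where "l \<in> S" "\<And>j. j \<noteq> m \<Longrightarrow> Poly_Mapping.lookup l j < Poly_Mapping.lookup l m"
  | (bounded) c D where "0 < c" "D + 2 \<le> CARD('n)" "CARD('n) * c = d + D"
      "\<And>l i. l \<in> S \<Longrightarrow> Poly_Mapping.lookup l i \<le> c"
      "\<And>B. card B = D \<Longrightarrow> const_expo c - sqfree B \<in> S"
proof (cases "\<exists>l\<in>S. \<exists>m. \<forall>j. j \<noteq> m \<longrightarrow> Poly_Mapping.lookup l j < Poly_Mapping.lookup l m")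
  case True
  then show ?thesis using unique_max by blast
next
  case False
  let ?P = "\<lambda>c. \<exists>l\<in>S. \<exists>i. Poly_Mapping.lookup l i = c"
  have bd: "Poly_Mapping.lookup l i \<le> d" if "l \<in> S" for l i
    using assms(3)[OF that] member_le_sum[of i UNIV "Poly_Mapping.lookup l"]
    by (simp add: expo_degree_def)
  define c where "c = Greatest ?P"
  have ex: "?P (Poly_Mapping.lookup l i)" if "l \<in> S" for l i using that by blast
  have le_c: "Poly_Mapping.lookup l i \<le> c" if "l \<in> S" for l i
    unfolding c_def by (rule Greatest_le_nat[of _ _ d]) (use that bd in auto)
  obtain l0 where l0: "l0 \<in> S" using assms(2) by blast
  have "?P c"
    unfolding c_def
    by (rule GreatestI_nat[where P = ?P and b = d, OF ex[OF l0, of undefined]]) (use bd in auto)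
  have "0 < c"
  proof (rule ccontr)
    assume "\<not> 0 < c"
    then have "expo_degree l0 = 0" using le_c[OF l0] by (simp add: expo_degree_def)
    then show False using assms(3)[OF l0] assms(4) by simp
  qed
  define r where "r l = card {i. Poly_Mapping.lookup l i = c}" for l :: "'n expo"
  obtain l where l: "l \<in> S" "\<exists>i. Poly_Mapping.lookup l i = c"
    and min: "\<And>l'. l' \<in> S \<Longrightarrow> \<exists>i. Poly_Mapping.lookup l' i = c \<Longrightarrow> r l \<le> r l'"
    using ex_has_least_nat[of "\<lambda>l. l \<in> S \<and> (\<exists>i. Poly_Mapping.lookup l i = c)" _ r] \<open>?P c\<close> by blast
  obtain m where m: "Poly_Mapping.lookup l m = c" using l by blast
  \<comment> \<open>A second maximal position: after a shift away from \<open>m\<close> the value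
    \<open>c\<close> is still attained at \<open>j\<close>, so the minimality of \<open>r\<close>
    applies. It also yields the 2 in \<open>D + 2 \<le> n\<close>.\<close>
  obtain j where j: "j \<noteq> m" "Poly_Mapping.lookup l j = c"
    using False l(1) m le_c[OF l(1)] by (metis le_neq_implies_less)
  have ge: "c - 1 \<le> Poly_Mapping.lookup l i" for i
  proof (rule ccontr)
    assume "\<not> c - 1 \<le> Poly_Mapping.lookup l i"
    then have i: "Suc (Poly_Mapping.lookup l i) < c" by simp
    then have ne: "i \<noteq> m" "i \<noteq> j" using m j by auto
    \<comment> \<open>The raised entry stays below \<open>c\<close>, so exactly one entry equal to
      \<open>c\<close> is lost.\<close>
    have ex: "Poly_Mapping.lookup (exch l i m) k = (if k = i then Suc (Poly_Mapping.lookup l i)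
        else if k = m then c - 1 else Poly_Mapping.lookup l k)" for k
      using m \<open>0 < c\<close> ne by (subst lookup_exch) auto
    have "exch l i m \<in> S"
      using assms(1) l(1) m le_c[OF l(1)] i unfolding shifted_exps_def by simp
    moreover have "\<exists>k. Poly_Mapping.lookup (exch l i m) k = c"
      using j ne by (intro exI[of _ j]) (simp add: ex)
    ultimately have "r l \<le> r (exch l i m)" by (rule min)
    moreover have "{k. Poly_Mapping.lookup (exch l i m) k = c} = {k. Poly_Mapping.lookup l k = c} - {m}"
      using i \<open>0 < c\<close> m by (auto simp: ex)
    moreover have "m \<in> {k. Poly_Mapping.lookup l k = c}" using m by simp
    ultimately have "r l \<le> r l - 1" unfolding r_def by (metis (no_types) card_Diff_singleton)
    moreover have "0 < r l" 
      using m unfolding r_def by (metis (mono_tags) card_gt_0_iff empty_iff finite mem_Collect_eq)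
    ultimately show False by simp
  qed
  define B where "B = {i. Poly_Mapping.lookup l i \<noteq> c}"
  have lB: "l = const_expo c - sqfree B"
  proof (rule poly_mapping_eqI)
    fix i
    show "Poly_Mapping.lookup l i = Poly_Mapping.lookup (const_expo c - sqfree B) i"
      using ge[of i] le_c[OF l(1), of i] by (auto simp: lookup_minus lookup_sqfree B_def)
  qed
  have "{m, j} \<inter> B = {}" using m j by (simp add: B_def)
  then have "card (B \<union> {m, j}) = card B + 2" using j(1) by (subst card_Un_disjoint) auto
  moreover have "card (B \<union> {m, j}) \<le> CARD('n)" by (rule card_mono) auto
  ultimately have D: "card B + 2 \<le> CARD('n)" by simp
  have "const_expo c = l + sqfree B"
    unfolding lB using \<open>0 < c\<close>
    by (intro poly_mapping_eqI) (auto simp: lookup_add lookup_minus lookup_sqfree)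
  then have "CARD('n) * c = d + card B"
    using assms(3)[OF l(1)] by (metis expo_degree_add expo_degree_const_expo expo_degree_sqfree)
  then show ?thesis
    using bounded[OF \<open>0 < c\<close> D] le_c shifted_sqfree_complement[OF assms(1) \<open>0 < c\<close>] l(1) lB by metis
qed

text \<open>Adding \<open>const_expo c - sqfree B\<close> removes the positions in \<open>B\<close>
  from those that attain the bound. Choosing \<open>B\<close> inside the remaining ones removes
  \<open>D\<close> at a time; when at most \<open>D\<close> are left, \<open>B\<close> takes all but
  one of them and is filled up elsewhere.\<close>

lemma sumpow_few_maxima:
  fixes S :: "'n::finite expo set"
  assumes "0 < c" "D < CARD('n)"
    and "\<And>B. card B = D \<Longrightarrow> const_expo c - sqfree B \<in> S"
    and "\<And>l i. l \<in> S \<Longrightarrow> Poly_Mapping.lookup l i \<le> c"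
  shows "\<exists>l\<in>sumpow S k. card {i. Poly_Mapping.lookup l i = k * c} = max 1 (CARD('n) - k * D)"
proof (induction k)
  case 0
  then show ?case by (simp add: max_def Suc_le_eq)
next
  case (Suc k)
  then obtain l where l: "l \<in> sumpow S k"
    "card {i. Poly_Mapping.lookup l i = k * c} = max 1 (CARD('n) - k * D)" by blast
  define T where "T = {i. Poly_Mapping.lookup l i = k * c}"
  have "0 < card T" using l(2) by (simp add: T_def)
  then obtain t where t: "t \<in> T" by (metis card_gt_0_iff ex_in_conv)
  have "\<exists>B. card B = D \<and> card (T - B) = max 1 (card T - D)"
  proof (cases "D < card T")
    case True
    then obtain B where B: "B \<subseteq> T" "card B = D" by (meson less_imp_le obtain_subset_with_card_n)
    then have "card (T - B) = card T - D" by (simp add: card_Diff_subset)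
    then show ?thesis using B True by (intro exI[of _ B]) simp
  next
    case False
    then have "card (T - {t}) \<le> D" using t by simp
    moreover have "D \<le> card (UNIV - {t})" using assms(2) by simp
    ultimately obtain B where B: "T - {t} \<subseteq> B" "B \<subseteq> UNIV - {t}" "card B = D"
      using exists_subset_between[of "T - {t}" D "UNIV - {t}"] by auto
    then have "T - B = {t}" using t by blast
    then show ?thesis using B False by (intro exI[of _ B]) simp
  qed
  then obtain B where B: "card B = D" "card (T - B) = max 1 (card T - D)" by blast
  let ?b = "const_expo c - sqfree B"
  have "l + ?b \<in> sumpow S (Suc k)" using l(1) assms(3)[OF B(1)] by auto
  moreover have "{i. Poly_Mapping.lookup (l + ?b) i = Suc k * c} = T - B"
  proof -
    have "Poly_Mapping.lookup (l + ?b) i = Suc k * c \<longleftrightarrow> i \<in> T - B" for i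
      using sumpow_bound[OF assms(4) l(1), of i] assms(1)
      by (auto simp: lookup_add lookup_minus lookup_sqfree T_def)
    then show ?thesis by blast
  qed
  moreover have "max 1 (card T - D) = max 1 (CARD('n) - Suc k * D)"
    using l(2) by (auto simp: T_def max_def)
  ultimately show ?case using B(2) by (intro bexI) auto
qed

section \<open>Associated primes\<close>

lemma primeideal_max_ideal: "primeideal (max_ideal :: ('n, 'k::field) mpoly set) polyring"
proof (rule primeidealI)
  show "ideal (max_ideal :: ('n, 'k) mpoly set) polyring"
    unfolding ideal_iff_idl by (rule idl_max_ideal)
  show "cring (polyring :: ('n, 'k) mpoly ring)" by (rule cring_from_type_algebra)
  show "carrier polyring \<noteq> (max_ideal :: ('n, 'k) mpoly set)"
    using max_ideal_neq_UNIV by (auto simp: ring_of_type_algebra_def)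
  have mem: "p \<in> max_ideal \<longleftrightarrow> Poly_Mapping.lookup p 0 = 0" for p :: "('n, 'k) mpoly"
    by (auto simp: max_ideal_eq monspan_def in_keys_iff)
  have scalar: "p - Poly_Mapping.single 0 (Poly_Mapping.lookup p 0) \<in> max_ideal" for p :: "('n, 'k) mpoly"
    by (simp add: mem lookup_minus)
  fix p q :: "('n, 'k) mpoly"
  assume "p \<otimes>\<^bsub>polyring\<^esub> q \<in> max_ideal"
  then have pq: "p * q \<in> max_ideal" by (simp add: ring_of_type_algebra_def)
  let ?a = "Poly_Mapping.lookup p 0" and ?b = "Poly_Mapping.lookup q 0"
  have "p * q - Poly_Mapping.single 0 ?a * Poly_Mapping.single 0 ?b =
      (p - Poly_Mapping.single 0 ?a) * q + Poly_Mapping.single 0 ?a * (q - Poly_Mapping.single 0 ?b)"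
    by (simp add: algebra_simps)
  also have "\<dots> \<in> max_ideal"
    by (intro idl_add[OF idl_max_ideal] idl_mult[OF idl_max_ideal] idl_mult_right[OF idl_max_ideal] scalar)
  finally have "Poly_Mapping.single 0 ?a * Poly_Mapping.single 0 ?b \<in> (max_ideal :: ('n, 'k) mpoly set)"
    using pq idl_cong[OF idl_max_ideal] by blast
  then have "?a * ?b = 0" unfolding mem by (simp add: mult_single)
  then show "p \<in> max_ideal \<or> q \<in> max_ideal" by (simp add: mem)
qed

text \<open>Every variable multiplies x^l/x_m into the ideal, but the monomial itself is outside; so
  the colon ideal is the whole maximal ideal.\<close>

lemma max_ideal_in_Ass:
  assumes "upclosed U" "0 < Poly_Mapping.lookup l m" "l \<in> U" "\<And>i. i \<noteq> m \<Longrightarrow> exch l i m \<in> U"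
    and "l - Poly_Mapping.single m 1 \<notin> U"
  shows "max_ideal \<in> Ass (monspan U :: ('n, 'k::field) mpoly set)"
proof -
  let ?q = "l - Poly_Mapping.single m 1"
  have "{a. a + ?q \<in> U} = {a. a \<noteq> 0}"
  proof (intro equalityI subsetI)
    fix a assume "a \<in> {a. a + ?q \<in> U}"
    then show "a \<in> {a. a \<noteq> 0}" using assms(5) by auto
  next
    fix a :: "'n expo" assume "a \<in> {a. a \<noteq> 0}"
    then obtain i where "0 < Poly_Mapping.lookup a i"
      by (auto simp: poly_mapping_eq_iff fun_eq_iff)
    then have a: "a = (a - Poly_Mapping.single i 1) + Poly_Mapping.single i 1"
      by (rule expo_split_single)
    have "?q + Poly_Mapping.single i 1 \<in> U"
      using assms(3,4) exch_eq[OF assms(2), of i] expo_split_single[OF assms(2)] by metis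
    then have "?q + Poly_Mapping.single i 1 + (a - Poly_Mapping.single i 1) \<in> U"
      using assms(1) unfolding upclosed_def by blast
    then show "a \<in> {a. a + ?q \<in> U}" by (subst a) (simp add: add_ac)
  qed
  then have "max_ideal = {g :: ('n, 'k) mpoly. g * xpow ?q \<in> monspan U}"
    unfolding monspan_colon max_ideal_eq by simp
  then show ?thesis unfolding Ass_def using primeideal_max_ideal by blast
qed

section \<open>The depth of the powers\<close>

text \<open>From this one formula monotonicity, both cases and the bounds on \<open>dstab\<close>
  follow by arithmetic; the equivalence for \<open>D = 0\<close> tells the cases apart.\<close>

lemma depth_powers:
  fixes S :: "'n::{finite,linorder} expo set"
  assumes "shifted_exps S" "S \<noteq> {}" "\<And>l. l \<in> S \<Longrightarrow> expo_degree l = d" "0 < d"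
  shows "\<exists>D. (D = 0 \<longleftrightarrow> (\<exists>a. S = {const_expo a})) \<and>
    (\<forall>k\<ge>1. depth_quot (monspan (up (sumpow S k)) :: ('n, 'k::field) mpoly set) = enat (CARD('n) - 1 - k * D) \<and>
      (CARD('n) - 1 \<le> k * D \<longrightarrow> max_ideal \<in> Ass (monspan (up (sumpow S k)) :: ('n, 'k) mpoly set)))"
proof -
  have up_deg: "k * d \<le> expo_degree a" if "a \<in> up (sumpow S k)" for a k
    by (rule up_degree_ge[OF sumpow_degree[OF assms(3)] that])
  have socle: "max_ideal \<in> Ass (monspan (up (sumpow S k)) :: ('n, 'k) mpoly set)"
    if l: "l \<in> sumpow S k" "0 < Poly_Mapping.lookup l m" "\<And>i. i \<noteq> m \<Longrightarrow> exch l i m \<in> sumpow S k" for l m k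
  proof (rule max_ideal_in_Ass[OF upclosed_up l(2)])
    have "expo_degree l = Suc (expo_degree (l - Poly_Mapping.single m 1))"
      using expo_split_single[OF l(2)] by (metis expo_degree_add expo_degree_single Suc_eq_plus1)
    then show "l - Poly_Mapping.single m 1 \<notin> up (sumpow S k)"
      using up_deg[of "l - Poly_Mapping.single m 1" k] sumpow_degree[OF assms(3) l(1)] by auto
  qed (use l subset_up[of "sumpow S k"] in blast)+
  show ?thesis
  proof (rule shifted_exps_cases[OF assms])
    fix l m
    assume unique_max: "l \<in> S" "\<And>j. j \<noteq> m \<Longrightarrow> Poly_Mapping.lookup l j < Poly_Mapping.lookup l m"
    have lm: "0 < Poly_Mapping.lookup l m"
    proof (rule ccontr)
      assume *: "\<not> 0 < Poly_Mapping.lookup l m"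
      have "l = 0"
      proof (rule poly_mapping_eqI)
        fix j show "Poly_Mapping.lookup l j = Poly_Mapping.lookup 0 j"
          using * unique_max(2)[of j] by (cases "j = m") auto
      qed
      then show False using assms(3)[OF unique_max(1)] assms(4) by simp
    qed
    have sh: "exch l i m \<in> S" if "i \<noteq> m" for i
      using assms(1) unique_max unfolding shifted_exps_def by (metis less_imp_le order_refl that)
    \<comment> \<open>Any element of the lower power may be added to \<open>l\<close>, as the shifts
      away from \<open>m\<close> can be carried out in the summand \<open>l\<close>.\<close>
    have ex: "\<exists>l'\<in>sumpow S k. 0 < Poly_Mapping.lookup l' m \<and> (\<forall>i. i \<noteq> m \<longrightarrow> exch l' i m \<in> sumpow S k)"
      if "1 \<le> k" for k
    proof -
      from that obtain k' where k: "k = Suc k'" by (cases k) auto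
      obtain a where "a \<in> sumpow S k'" using sumpow_nonempty[OF assms(2)] by blast
      then show ?thesis
        using unique_max(1) lm sh exch_add[OF lm, of a]
        by (intro bexI[of _ "a + l"]) (auto simp: k lookup_add)
    qed
    have *: "depth_quot (monspan (up (sumpow S k)) :: ('n, 'k) mpoly set) = 0 \<and>
        max_ideal \<in> Ass (monspan (up (sumpow S k)) :: ('n, 'k) mpoly set)" if "1 \<le> k" for k
    proof -
      from ex[OF that] obtain l' where l': "l' \<in> sumpow S k" "0 < Poly_Mapping.lookup l' m"
        "\<And>i. i \<noteq> m \<Longrightarrow> exch l' i m \<in> sumpow S k" by blast
      have "depth_quot (monspan (up (sumpow S k)) :: ('n, 'k) mpoly set) \<le> enat (card {m} - 1)"
        using l' up_deg[of _ k] sumpow_degree[OF assms(3) l'(1)] subset_up[of "sumpow S k"]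
        by (intro depth_quot_le_card[OF upclosed_up, of _ l' m]) auto
      then show ?thesis using socle[OF l'] by (simp add: zero_enat_def[symmetric])
    qed
    \<comment> \<open>With a single variable the unique maximum is vacuous: the witness
      \<open>n - 1\<close> is zero and the ideal is principal.\<close>
    have "CARD('n) - 1 = 0 \<longleftrightarrow> (\<exists>a. S = {const_expo a})"
    proof
      assume "CARD('n) - 1 = 0"
      then have card1: "CARD('n) = 1" using zero_less_card_finite[where 'a = 'n] by linarith
      then have "l' = const_expo d" if "l' \<in> S" for l'
        using expo_eq_const_expo assms(3)[OF that] by blast
      then show "\<exists>a. S = {const_expo a}" using assms(2) by (intro exI[of _ d]) blast
    next
      assume "\<exists>a. S = {const_expo a}"
      then have "j = m" for j using unique_max by force
      then have "(UNIV :: 'n set) = {m}" by blast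
      then have "CARD('n) = card {m}" by (rule arg_cong)
      then show "CARD('n) - 1 = 0" by simp
    qed
    moreover have "enat (CARD('n) - 1 - k * (CARD('n) - 1)) = 0" if "1 \<le> k" for k
      using that by (cases k) (simp_all add: zero_enat_def)
    ultimately show ?thesis using * by (intro exI[of _ "CARD('n) - 1"]) simp
  next
    fix c D
    assume bounded: "0 < c" "D + 2 \<le> CARD('n)" "CARD('n) * c = d + D"
      "\<And>l i. l \<in> S \<Longrightarrow> Poly_Mapping.lookup l i \<le> c"
      "\<And>B. card B = D \<Longrightarrow> const_expo c - sqfree B \<in> S"
    have "depth_quot (monspan (up (sumpow S k)) :: ('n, 'k) mpoly set) = enat (CARD('n) - 1 - k * D) \<and>
      (CARD('n) - 1 \<le> k * D \<longrightarrow> max_ideal \<in> Ass (monspan (up (sumpow S k)) :: ('n, 'k) mpoly set))"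
      if k: "1 \<le> k" for k
    proof -
      let ?J = "monspan (up (sumpow S k)) :: ('n, 'k) mpoly set"
      have kc: "0 < k * c" using k bounded(1) by simp
      obtain l where l: "l \<in> sumpow S k"
        "card {i. Poly_Mapping.lookup l i = k * c} = max 1 (CARD('n) - k * D)"
        using sumpow_few_maxima[of c D S k] bounded by auto
      define T where "T = {i. Poly_Mapping.lookup l i = k * c}"
      have T: "card T = max 1 (CARD('n) - k * D)" using l(2) by (simp add: T_def)
      then have "0 < card T" by simp
      then obtain m where m: "m \<in> T" by (metis card_gt_0_iff ex_in_conv)
      have lt: "Poly_Mapping.lookup l i < k * c" if "i \<notin> T" for i
        using that sumpow_bound[OF bounded(4) l(1), of i] by (simp add: T_def)
      have exl: "exch l i m \<in> sumpow S k" if "i \<notin> T" for i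
        using sumpow_exch[OF assms(1) bounded(4) l(1) _ lt[OF that]] m by (simp add: T_def)
      have lm: "0 < Poly_Mapping.lookup l m" using m kc by (simp add: T_def)
      have "depth_quot ?J \<le> enat (card T - 1)"
        using l(1) exl m lm up_deg[of _ k] sumpow_degree[OF assms(3) l(1)] subset_up[of "sumpow S k"]
        by (intro depth_quot_le_card[OF upclosed_up, of _ l m]) auto
      then have upper: "depth_quot ?J \<le> enat (CARD('n) - 1 - k * D)"
        using T by (simp add: max_def split: if_splits)
      have lower: "enat (CARD('n) - 1 - k * D) \<le> depth_quot ?J"
      proof (cases "k * D + 2 \<le> CARD('n)")
        case True
        let ?s = "CARD('n) - 1 - k * D"
        have keys: "Poly_Mapping.keys (const_expo (k * c) :: 'n expo) = UNIV"
          using kc by (auto simp: in_keys_iff)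
        \<comment> \<open>No variable is dead at the start, and \<open>?s\<close> exhausts the
          admissible range: \<open>?s + 1 + k * D = n\<close>.\<close>
        have "wreg (monspan (up (sumpow S k) \<union> dead UNIV)) (map (esym :: nat \<Rightarrow> ('n, 'k) mpoly) [1..<Suc ?s])"
        proof (rule esym_wreg_closed[where c = "const_expo (k * c)" and D = "k * D"])
          fix l' assume l': "l' \<in> sumpow S k"
          show "Poly_Mapping.lookup l' i \<le> Poly_Mapping.lookup (const_expo (k * c)) i" for i
            using sumpow_bound[OF bounded(4) l'] by simp
          have "CARD('n) * (k * c) = k * d + k * D"
            using bounded(3) by (metis distrib_left mult.left_commute)
          then show "expo_degree l' + k * D = expo_degree (const_expo (k * c) :: 'n expo)"
            using sumpow_degree[OF assms(3) l'] by (simp add: expo_degree_const_expo)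
          fix i m assume "Poly_Mapping.lookup l' i < Poly_Mapping.lookup (const_expo (k * c)) i"
            "Poly_Mapping.lookup l' m = Poly_Mapping.lookup (const_expo (k * c)) m"
          then show "exch l' i m \<in> sumpow S k"
            using sumpow_exch[OF assms(1) bounded(4) l'] by simp
        qed (use True in \<open>simp_all add: keys\<close>)
        moreover have "dead UNIV = ({} :: 'n expo set)" by (simp add: dead_def)
        ultimately have "wreg ?J (map esym [1..<Suc ?s])" by (simp del: upt_Suc)
        moreover have "?J \<subseteq> max_ideal"
        proof -
          have "0 \<notin> up (sumpow S k)" using up_deg[of 0 k] k assms(4) by auto
          then show ?thesis by (auto simp: max_ideal_eq monspan_def)
        qed
        moreover have "set (map esym [1..<Suc ?s]) \<subseteq> (max_ideal :: ('n, 'k) mpoly set)"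
          by (auto intro!: esym_in_max_ideal)
        ultimately have "enat (length (map (esym :: nat \<Rightarrow> ('n, 'k) mpoly) [1..<Suc ?s])) \<le> depth_quot ?J"
          by (intro depth_quot_ge idl_monspan[OF upclosed_up])
        then show ?thesis by (simp del: upt_Suc)
      next
        case False
        then show ?thesis by (simp add: zero_enat_def[symmetric])
      qed
      \<comment> \<open>Once \<open>k * D\<close> reaches \<open>n - 1\<close>, a single position of
        \<open>l\<close> attains the bound, and all shifts away from it are available.\<close>
      have "max_ideal \<in> Ass ?J" if "CARD('n) - 1 \<le> k * D"
      proof -
        have "card T = 1" using T that by (auto simp: max_def)
        then have "T = {m}" using m by (metis card_1_singletonE singletonD)
        then show ?thesis using socle[OF l(1) lm] exl by simp
      qed
      then show ?thesis using upper lower by simp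
    qed
    moreover have "D = 0 \<longleftrightarrow> (\<exists>a. S = {const_expo a})"
    proof
      assume D: "D = 0"
      have "l = const_expo c" if "l \<in> S" for l
      proof -
        have eq: "const_expo c = l + (const_expo c - l)"
          using bounded(4)[OF that] by (intro expo_eq_add_minus) simp
        have "expo_degree (const_expo c :: 'n expo) = expo_degree l"
          using bounded(3) D assms(3)[OF that] by (simp add: expo_degree_const_expo)
        then have "const_expo c - l = 0"
          using eq by (metis add_cancel_left_right expo_degree_add expo_degree_eq_0)
        then show ?thesis using eq by simp
      qed
      then show "\<exists>a. S = {const_expo a}" using assms(2) by blast
    next
      assume "\<exists>a. S = {const_expo a}"
      then obtain a where a: "S = {const_expo a}" by blast
      obtain B :: "'n set" where B: "card B = D"
        using bounded(2) obtain_subset_with_card_n[of D "UNIV :: 'n set"] by auto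
      then have eq: "const_expo c - sqfree B = const_expo a" using bounded(5) a by blast
      have ev: "a = (if i \<in> B then c - 1 else c)" for i
        using arg_cong[OF eq, of "\<lambda>l. Poly_Mapping.lookup l i"] by (auto simp: lookup_minus lookup_sqfree)
      have "B \<noteq> UNIV" using B bounded(2) by auto
      then obtain j where "j \<notin> B" by blast
      then have "a = c" using ev[of j] by simp
      then have "i \<notin> B" for i using ev[of i] bounded(1) by (metis diff_less less_irrefl zero_less_one)
      then have "B = {}" by blast
      then show "D = 0" using B by simp
    qed
    ultimately show ?thesis by (intro exI[of _ D]) simp
  qed
qed

section \<open>Symmetric shifted ideals\<close>

lemma lookup_map_key_bij:
  "bij s \<Longrightarrow> Poly_Mapping.lookup (Poly_Mapping.map_key s p) i = Poly_Mapping.lookup p (s i)"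
  using map_key.rep_eq[of s p] by (simp add: bij_def)

lemma map_key_inverse:
  assumes "bij s" "\<And>i. s (t i) = i"
  shows "Poly_Mapping.map_key t (Poly_Mapping.map_key s p) = p"
proof -
  have "bij t" using assms by (metis bij_betw_def bij_imp_bij_inv inj_imp_inv_eq inv_f_eq surj_f_inv_f ext)
  then show ?thesis by (intro poly_mapping_eqI) (simp add: lookup_map_key_bij assms)
qed

text \<open>\<open>perm_act\<close> is a \<open>map_key\<close> along \<open>map_key s\<close>, and
  the facts on \<open>map_key\<close> ask for an injective map.\<close>

lemma bij_map_key:
  fixes s :: "'n \<Rightarrow> 'n"
  assumes "bij s"
  shows "bij (Poly_Mapping.map_key s)"
proof (rule bijI')
  have inv: "s (inv_into UNIV s i) = i" "inv_into UNIV s (s i) = i" for i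
    using assms by (simp_all add: bij_def surj_f_inv_f)
  show "Poly_Mapping.map_key s x = Poly_Mapping.map_key s y \<longleftrightarrow> x = y" for x y
    using map_key_inverse[OF assms inv(1)] by metis
  show "\<exists>x. y = Poly_Mapping.map_key s x" for y
    using map_key_inverse[OF bij_imp_bij_inv[OF assms] inv(2)] by metis
qed

lemma perm_act_xpow:
  assumes "bij s"
  shows "perm_act s (xpow (Poly_Mapping.map_key s l)) = xpow l"
  unfolding perm_act_def xpow_def
  using bij_is_inj[OF bij_map_key[OF assms]] by (rule map_key_single)

lemma keys_perm_act:
  assumes "bij s"
  shows "Poly_Mapping.keys (perm_act s p) = Poly_Mapping.map_key s -` Poly_Mapping.keys p"
  unfolding perm_act_def by (rule keys_map_key[OF bij_is_inj[OF bij_map_key[OF assms]]])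

lemma perm_act_inverse:
  assumes "bij s" "\<And>i. s (t i) = i" "\<And>i. t (s i) = i"
  shows "perm_act t (perm_act s p) = p"
  unfolding perm_act_def
proof (rule map_key_inverse)
  have "bij t" using assms by (intro o_bij[of s]) auto
  show "bij (Poly_Mapping.map_key s :: 'a expo \<Rightarrow> 'a expo)" by (rule bij_map_key[OF assms(1)])
  show "Poly_Mapping.map_key s (Poly_Mapping.map_key t m) = m" for m :: "'a expo"
    by (rule map_key_inverse[OF \<open>bij t\<close> assms(3)])
qed

lemma sym_map_key_mem:
  assumes "sym_monomial_ideal I" "bij s" "(xpow l :: ('n, 'k::field) mpoly) \<in> I"
  shows "(xpow (Poly_Mapping.map_key s l) :: ('n, 'k) mpoly) \<in> I"
proof -
  let ?t = "inv_into UNIV s"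
  have t: "bij ?t" by (rule bij_imp_bij_inv[OF assms(2)])
  have "Poly_Mapping.map_key ?t (Poly_Mapping.map_key s l) = l"
    using assms(2) by (intro map_key_inverse) (simp_all add: bij_def surj_f_inv_f)
  then have "perm_act ?t (xpow l) = (xpow (Poly_Mapping.map_key s l) :: ('n, 'k) mpoly)"
    using perm_act_xpow[OF t, of "Poly_Mapping.map_key s l"] by simp
  then show ?thesis using assms(1,3) t unfolding sym_monomial_ideal_def by (metis imageI)
qed

text \<open>Ties among the maximal entries have to be broken in favour of \<open>m\<close>; hence
  \<open>m\<close> is taken out before sorting and appended at the end.\<close>

lemma sorting_permutation:
  fixes f :: "'n::{finite,linorder} \<Rightarrow> nat"
  assumes "\<And>j. f j \<le> f m"
  obtains s :: "'n \<Rightarrow> 'n" where "bij s" "mono (f \<circ> s)" "s (Max UNIV) = m"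
proof -
  define ys where "ys = sort_key f (sorted_list_of_set (UNIV - {m})) @ [m]"
  have set: "set ys = UNIV" and dist: "distinct ys" unfolding ys_def by auto
  then have len: "length ys = CARD('n)" by (metis distinct_card)
  have sorted: "sorted (map f ys)" unfolding ys_def using assms by (auto simp: sorted_append)
  \<comment> \<open>The rank of \<open>i\<close>, which turns list positions into elements of the
    index type.\<close>
  define p where "p i = card {..<i}" for i :: 'n
  have p_mono: "p i < p j" if "i < j" for i j
    unfolding p_def using that by (intro psubset_card_mono) auto
  have p_less: "p i < CARD('n)" for i
    unfolding p_def by (intro psubset_card_mono) auto
  have p_max: "p (Max UNIV) = CARD('n) - 1"
  proof -
    have "{..<Max UNIV} = UNIV - {Max UNIV :: 'n}"
      using Max_ge[of UNIV] by (auto simp: less_le)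
    then show ?thesis by (simp add: p_def)
  qed
  define s where "s i = ys ! p i" for i
  have "inj s"
  proof (rule injI)
    fix i j assume "s i = s j"
    then have "p i = p j" using dist p_less len by (simp add: s_def nth_eq_iff_index_eq)
    then show "i = j" using p_mono by (metis less_irrefl linorder_less_linear)
  qed
  then have "bij s" by (simp add: bij_def finite_UNIV_inj_surj)
  moreover have "mono (f \<circ> s)"
  proof (rule monoI)
    fix i j :: 'n assume "i \<le> j"
    then have "p i \<le> p j" unfolding p_def by (intro card_mono) auto
    then show "(f \<circ> s) i \<le> (f \<circ> s) j"
      using sorted_nth_mono[OF sorted, of "p i" "p j"] p_less len by (simp add: s_def)
  qed
  moreover have "s (Max UNIV) = m"
    using len unfolding s_def p_max by (simp add: ys_def nth_append)
  ultimately show thesis by (rule that)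
qed

text \<open>Sort the exponent so that \<open>m\<close> becomes the last index, apply the shift there
  and undo the permutation.\<close>

lemma sym_shifted_exch:
  fixes I :: "('n::{finite,linorder}, 'k::field) mpoly set"
  assumes "sym_shifted I" "(xpow l :: ('n, 'k) mpoly) \<in> I"
    and "\<And>j. Poly_Mapping.lookup l j \<le> Poly_Mapping.lookup l m"
    and "Poly_Mapping.lookup l i < Poly_Mapping.lookup l m"
  shows "(xpow (exch l i m) :: ('n, 'k) mpoly) \<in> I"
proof -
  have sym: "sym_monomial_ideal I" using assms(1) by (simp add: sym_shifted_def)
  obtain s :: "'n \<Rightarrow> 'n" where s: "bij s" "mono (Poly_Mapping.lookup l \<circ> s)" "s (Max UNIV) = m"
    by (rule sorting_permutation[of "Poly_Mapping.lookup l" m, OF assms(3)])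
  let ?l = "Poly_Mapping.map_key s l" and ?i = "inv_into UNIV s i"
  have inv: "s (inv_into UNIV s j) = j" "inv_into UNIV s (s j) = j" for j using s(1) by (simp_all add: bij_def surj_f_inv_f)
  have l: "Poly_Mapping.lookup ?l j = Poly_Mapping.lookup l (s j)" for j
    by (rule lookup_map_key_bij[OF s(1)])
  have "Poly_Mapping.lookup ?l = Poly_Mapping.lookup l \<circ> s" using l by (simp add: fun_eq_iff)
  then have "?l \<in> P_of I"
    using s(2) sym_map_key_mem[OF sym s(1) assms(2)] by (simp add: P_of_def Pn_def)
  moreover have "?i < Max UNIV"
  proof -
    have "?i \<noteq> Max UNIV" using assms(4) s(3) inv(1)[of i] by auto
    then show ?thesis by (simp add: less_le)
  qed
  ultimately have "xpow (exch ?l ?i (Max UNIV)) \<in> I"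
    using assms(1,4) s(3) unfolding sym_shifted_def by (auto simp: l inv)
  from sym_map_key_mem[OF sym bij_imp_bij_inv[OF s(1)] this]
  have "(xpow (Poly_Mapping.map_key (inv_into UNIV s) (exch ?l ?i (Max UNIV))) :: ('n, 'k) mpoly) \<in> I" .
  moreover have "Poly_Mapping.map_key (inv_into UNIV s) (exch ?l ?i (Max UNIV)) = exch l i m"
  proof (rule poly_mapping_eqI)
    fix j
    have "?i = inv_into UNIV s j \<longleftrightarrow> i = j" "Max UNIV = inv_into UNIV s j \<longleftrightarrow> m = j" using inv s(3) by metis+
    then show "Poly_Mapping.lookup (Poly_Mapping.map_key (inv_into UNIV s) (exch ?l ?i (Max UNIV))) j =
        Poly_Mapping.lookup (exch l i m) j"
      by (simp add: lookup_map_key_bij[OF bij_imp_bij_inv[OF s(1)]] exch_def lookup_add lookup_minus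
          lookup_single l inv when_def)
  qed
  ultimately show ?thesis by simp
qed

lemma sym_shifted_generators:
  fixes I :: "('n::{finite,linorder}, 'k::field) mpoly set"
  assumes "sym_shifted I" "I \<noteq> {0}" "I \<noteq> UNIV" "\<forall>l\<in>min_gens I. expo_degree l = d"
  obtains S where "I = monspan (up S)" "S \<noteq> {}" "0 < d" "\<And>l. l \<in> S \<Longrightarrow> expo_degree l = d" "shifted_exps S"
proof -
  obtain M where "I = Idl\<^bsub>polyring\<^esub> (xpow ` M)"
    using assms(1) unfolding sym_shifted_def sym_monomial_ideal_def monomial_ideal_def by blast
  then have I: "I = monspan (up M)" by (simp add: genideal_xpow)
  \<comment> \<open>With all elements of degree \<open>d\<close>, closure under shifts is immediate,
    since these preserve the degree.\<close>
  define S where "S = {l \<in> up M. expo_degree l = d}"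
  have "up M = up S"
  proof
    show "up S \<subseteq> up M"
    proof
      fix l assume "l \<in> up S"
      then obtain a b where "l = a + b" "a \<in> S" unfolding up_def by blast
      then have "l = a + b" "a \<in> up M" by (simp_all add: S_def)
      then show "l \<in> up M" using upclosed_up[of M] unfolding upclosed_def by blast
    qed
    show "up M \<subseteq> up S"
    proof
      fix l assume l: "l \<in> up M"
      \<comment> \<open>A divisor of \<open>l\<close> of least degree in the ideal is a minimal
        generator, hence of degree \<open>d\<close>.\<close>
      obtain a b where ab: "a \<in> up M" "l = a + b"
        and min: "\<And>a' b'. a' \<in> up M \<Longrightarrow> l = a' + b' \<Longrightarrow> expo_degree a \<le> expo_degree a'"
        using ex_has_least_nat[of "\<lambda>a. a \<in> up M \<and> (\<exists>b. l = a + b)" l expo_degree] l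
        by (metis add.right_neutral)
      have "a \<in> min_gens I"
        unfolding min_gens_def
      proof (intro CollectI conjI allI impI)
        show "xpow a \<in> I" using ab(1) I by simp
        fix m assume m: "(xpow m :: ('n, 'k) mpoly) \<in> I \<and> (xpow m :: ('n, 'k) mpoly) dvd xpow a"
        then obtain r :: "('n, 'k) mpoly" where "xpow a = r * xpow m" by (metis dvdE mult.commute)
        then have "{a} = (\<lambda>k. k + m) ` Poly_Mapping.keys r" by (metis keys_mult_xpow keys_xpow)
        then obtain b' where b': "a = m + b'" by (metis add.commute image_iff insertI1)
        have "expo_degree a \<le> expo_degree m"
          using m I ab(2) b' by (intro min[of m "b' + b"]) (auto simp: add.assoc)
        then have "b' = 0" unfolding b' by (simp add: expo_degree_add expo_degree_eq_0)
        then show "m = a" using b' by simp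
      qed
      then have "a \<in> S" using assms(4) ab(1) by (simp add: S_def)
      then show "l \<in> up S" unfolding ab(2) by (rule upI)
    qed
  qed
  then have IS: "I = monspan (up S)" using I by simp
  have ne: "S \<noteq> {}"
  proof
    assume "S = {}"
    then have "I = {0}" unfolding IS by (auto simp: up_def monspan_def)
    then show False using assms(2) by simp
  qed
  have "0 < d"
  proof (rule ccontr)
    assume "\<not> 0 < d"
    then have "S \<subseteq> {0}" by (auto simp: S_def expo_degree_eq_0)
    then have "up S = UNIV" using ne by (intro up_zero) auto
    then show False using assms(3) IS by (simp add: monspan_def)
  qed
  have "shifted_exps S"
    unfolding shifted_exps_def
  proof (intro ballI allI impI)
    fix l i m assume l: "l \<in> S" and
      m: "(\<forall>j. Poly_Mapping.lookup l j \<le> Poly_Mapping.lookup l m) \<and> Poly_Mapping.lookup l i < Poly_Mapping.lookup l m"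
    have "(xpow (exch l i m) :: ('n, 'k) mpoly) \<in> I"
      using sym_shifted_exch[OF assms(1), of l m i] l m I by (simp add: S_def)
    moreover have "expo_degree (exch l i m) = d"
      using l m by (subst expo_degree_exch) (auto simp: S_def)
    ultimately show "exch l i m \<in> S" using I by (simp add: S_def)
  qed
  then show thesis using that[OF IS ne \<open>0 < d\<close>] by (simp add: S_def)
qed

section \<open>The principal case\<close>

lemma up_const_expo: "up {const_expo a} = {l :: 'n::finite expo. \<forall>i. a \<le> Poly_Mapping.lookup l i}"
proof (intro equalityI subsetI)
  fix l :: "'n expo" assume "l \<in> {l. \<forall>i. a \<le> Poly_Mapping.lookup l i}"
  then have "l = const_expo a + (l - const_expo a)" by (intro expo_eq_add_minus) simp
  then show "l \<in> up {const_expo a}" by (metis insertI1 upI)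
qed (auto simp: up_def lookup_add)

text \<open>A shift lowers only an entry that exceeds another one, so all entries stay at least
  \<open>a\<close>. Hence the principal ideal is itself strongly shifted.\<close>

lemma Sss_const_expo:
  "Sss {const_expo a} = (monspan (up {const_expo a}) :: ('n::{finite,linorder}, 'k::field) mpoly set)"
proof -
  let ?J = "monspan (up {const_expo a}) :: ('n, 'k) mpoly set"
  have perm: "perm_act s p \<in> ?J" if "bij s" "p \<in> ?J" for s and p :: "('n, 'k) mpoly"
    unfolding monspan_def up_const_expo
  proof (intro CollectI subsetI allI)
    fix m i assume "m \<in> Poly_Mapping.keys (perm_act s p)"
    then have "Poly_Mapping.map_key s m \<in> up {const_expo a}"
      using that(2) unfolding keys_perm_act[OF that(1)] monspan_def by auto
    then have "\<forall>i. a \<le> Poly_Mapping.lookup m (s i)"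
      using that(1) by (simp add: up_const_expo lookup_map_key_bij)
    then show "a \<le> Poly_Mapping.lookup m i"
      using that(1) by (metis bij_is_surj surjD)
  qed
  have "perm_act s ` ?J = ?J" if "bij s" for s
  proof
    show "perm_act s ` ?J \<subseteq> ?J" using perm[OF that] by blast
    show "?J \<subseteq> perm_act s ` ?J"
    proof
      fix p assume p: "p \<in> ?J"
      have inv: "s (inv_into UNIV s i) = i" "inv_into UNIV s (s i) = i" for i
        using that by (simp_all add: bij_def surj_f_inv_f)
      have "p = perm_act s (perm_act (inv_into UNIV s) p)"
        by (rule perm_act_inverse[OF bij_imp_bij_inv[OF that] inv(2,1), symmetric])
      then show "p \<in> perm_act s ` ?J"
        using perm[OF bij_imp_bij_inv[OF that] p] by blast
    qed
  qed
  moreover have "monomial_ideal ?J"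
    unfolding monomial_ideal_def using genideal_xpow[of "{const_expo a}"] by metis
  ultimately have "sym_strongly_shifted ?J"
    unfolding sym_strongly_shifted_def sym_monomial_ideal_def
  proof (intro conjI ballI allI impI)
    fix l :: "'n expo" and i j
    assume "l \<in> P_of ?J" and ij: "i < j \<and> Poly_Mapping.lookup l i < Poly_Mapping.lookup l j"
    then have l: "\<forall>k. a \<le> Poly_Mapping.lookup l k" by (simp add: P_of_def up_const_expo)
    then have "a \<le> Poly_Mapping.lookup (exch l i j) k" for k
      using ij l[rule_format, of k] le_SucI[OF l[rule_format, of i]]
        le_less_trans[OF l[rule_format, of i], of "Poly_Mapping.lookup l j"]
      by (subst lookup_exch) auto
    then show "(xpow (exch l i j) :: ('n, 'k) mpoly) \<in> ?J" by (simp add: up_const_expo)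
  qed auto
  moreover have "xpow ` {const_expo a} \<subseteq> ?J" by (simp add: up_const_expo)
  moreover have "?J \<subseteq> J" if "sym_strongly_shifted J" "xpow ` {const_expo a} \<subseteq> J" for J :: "('n, 'k) mpoly set"
  proof -
    from that(1) obtain M where "J = Idl\<^bsub>polyring\<^esub> (xpow ` M)"
      unfolding sym_strongly_shifted_def sym_monomial_ideal_def monomial_ideal_def by blast
    then have "idl J" by (simp add: idl_genideal)
    with that(2) show ?thesis
      unfolding genideal_xpow[symmetric] genideal_eq by blast
  qed
  ultimately show ?thesis unfolding Sss_def by blast
qed

lemma xpow_const_expo: "(\<Prod>i\<in>UNIV. var i ^ a) = (xpow (const_expo a) :: ('n::finite, 'k::field) mpoly)"
proof -
  have var: "var i ^ a = (xpow (Poly_Mapping.single i a) :: ('n, 'k) mpoly)" for i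
  proof (induction a)
    case (Suc a)
    have "Poly_Mapping.single i (Suc a) = Poly_Mapping.single i 1 + Poly_Mapping.single i a"
      by (simp flip: single_add)
    then show ?case using Suc by (simp add: var_def xpow_add)
  qed (simp add: xpow_def)
  have "(\<Prod>i\<in>A. xpow (f i)) = (xpow (\<Sum>i\<in>A. f i) :: ('n, 'k) mpoly)" if "finite A"
    for A :: "'n set" and f
    using that by (induction A rule: finite_induct) (simp_all add: xpow_add, simp add: xpow_def)
  then show ?thesis unfolding var const_expo_def by simp
qed

text \<open>If the ideals agree, each x^l with \<open>l \<in> S\<close> is a multiple of the
  principal generator, which is a multiple of some generator from \<open>S\<close>; equal degrees
  force equality.\<close>

lemma eq_Sss_const_expo_iff:
  fixes S :: "'n::{finite,linorder} expo set"
  assumes "S \<noteq> {}" "\<And>l. l \<in> S \<Longrightarrow> expo_degree l = d"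
  shows "(monspan (up S) :: ('n, 'k::field) mpoly set) = Sss {const_expo a} \<longleftrightarrow> S = {const_expo a}"
proof
  assume "(monspan (up S) :: ('n, 'k) mpoly set) = Sss {const_expo a}"
  then have "l \<in> up S \<longleftrightarrow> l \<in> up {const_expo a}" for l
    unfolding Sss_const_expo by (metis xpow_mem_monspan)
  then have up: "up S = up {const_expo a}" by blast
  then have "const_expo a \<in> up S" using subset_up[of "{const_expo a :: 'n expo}"] by blast
  then obtain l' b' where l': "const_expo a = l' + b'" "l' \<in> S" unfolding up_def by blast
  have "l = const_expo a" if "l \<in> S" for l
  proof -
    have "l \<in> up {const_expo a}" using that subset_up[of S] up by blast
    then obtain b where b: "l = const_expo a + b" unfolding up_def by blast
    have "expo_degree l = expo_degree l' + expo_degree b' + expo_degree b"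
      unfolding b l'(1) by (simp add: expo_degree_add)
    then have "b = 0" using assms(2)[OF that] assms(2)[OF l'(2)] by (simp add: expo_degree_eq_0)
    then show ?thesis using b by simp
  qed
  then show "S = {const_expo a}" using assms(1) by blast
qed (simp add: Sss_const_expo)

theorem proposition5p1:
  fixes I :: "('n::{finite,linorder}, 'k::field) mpoly set"
  assumes "sym_shifted I" and "I \<noteq> {0}" and "I \<noteq> UNIV"
    and "\<exists>d. \<forall>l\<in>min_gens I. expo_degree l = d"
  shows "(\<forall>k\<ge>1. depth_quot (ideal_power I k) \<ge> depth_quot (ideal_power I (k + 1)))
    \<and> (\<forall>a. I = Sss {const_expo a} \<longrightarrow>
          I = Idl\<^bsub>polyring\<^esub> {\<Prod>i\<in>UNIV. var i ^ a}
          \<and> (\<forall>k\<ge>1. depth_quot (ideal_power I k) = enat (CARD('n) - 1))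
          \<and> dstab I = 1)
    \<and> ((\<nexists>a. I = Sss {const_expo a}) \<longrightarrow>
          (\<forall>k. 1 \<le> k \<and> k \<le> CARD('n) - 1 \<longrightarrow>
              depth_quot (ideal_power I k) \<le> enat (CARD('n) - k - 1))
          \<and> (\<forall>k\<ge>CARD('n) - 1. depth_quot (ideal_power I k) = 0)
          \<and> dstab I \<le> CARD('n) - 1
          \<and> (\<forall>k\<ge>CARD('n) - 1. max_ideal \<in> Ass (ideal_power I k)))"
proof -
  obtain d where "\<forall>l\<in>min_gens I. expo_degree l = d" using assms(4) by blast
  then obtain S where S: "I = monspan (up S)" "S \<noteq> {}" "0 < d" "\<And>l. l \<in> S \<Longrightarrow> expo_degree l = d"
    "shifted_exps S"
    using sym_shifted_generators[OF assms(1-3)] by metis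
  have principal: "I = Sss {const_expo a} \<longleftrightarrow> S = {const_expo a}" for a
    unfolding S(1) by (rule eq_Sss_const_expo_iff[OF S(2,4)])
  obtain D where D: "D = 0 \<longleftrightarrow> (\<exists>a. I = Sss {const_expo a})"
    and depth: "\<And>k. 1 \<le> k \<Longrightarrow> depth_quot (ideal_power I k) = enat (CARD('n) - 1 - k * D)"
    and Ass: "\<And>k. 1 \<le> k \<Longrightarrow> CARD('n) - 1 \<le> k * D \<Longrightarrow> max_ideal \<in> Ass (ideal_power I k)"
    using depth_powers[OF S(5,2,4,3), where ?'k = 'k]
    unfolding principal unfolding S(1) ideal_power_monspan by metis
  have dstab_le: "dstab I \<le> k0"
    if "1 \<le> k0" "\<And>k. k0 \<le> k \<Longrightarrow> depth_quot (ideal_power I k) = depth_quot (ideal_power I k0)" for k0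
    unfolding dstab_def using that by (intro Least_le) blast
  show ?thesis
  proof (intro conjI allI impI)
    fix k :: nat assume "1 \<le> k"
    then show "depth_quot (ideal_power I (k + 1)) \<le> depth_quot (ideal_power I k)"
      using depth[of k] depth[of "k + 1"] by simp
  next
    fix a assume a: "I = Sss {const_expo a}"
    then show "I = Idl\<^bsub>polyring\<^esub> {\<Prod>i\<in>UNIV. var i ^ a}"
      unfolding xpow_const_expo Sss_const_expo genideal_xpow[symmetric] by simp
    have "D = 0" using D a by blast
    then show const: "depth_quot (ideal_power I k) = enat (CARD('n) - 1)" if "1 \<le> k" for k
      using depth[OF that] by simp
    have "dstab I \<le> 1" by (rule dstab_le) (simp, metis const order_refl)
    moreover have "1 \<le> dstab I"
    proof -
      let ?P = "\<lambda>k0. 1 \<le> k0 \<and>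
        (\<forall>k\<ge>k0. depth_quot (ideal_power I k) = depth_quot (ideal_power I k0))"
      have "?P 1" by (metis const order_refl)
      then have "?P (Least ?P)" by (rule LeastI)
      then show ?thesis unfolding dstab_def by (rule conjunct1)
    qed
    ultimately show "dstab I = 1" by simp
  next
    assume np: "\<nexists>a. I = Sss {const_expo a}"
    then have D1: "1 \<le> D" using D by (simp add: Suc_le_eq)
    \<comment> \<open>With one variable the ideal would be principal. So \<open>n - 1\<close> is at
      least 1, as a candidate for \<open>dstab\<close> must be.\<close>
    have "CARD('n) \<noteq> 1"
    proof
      assume "CARD('n) = 1"
      then have "l = const_expo d" if "l \<in> S" for l
        using expo_eq_const_expo S(4)[OF that] by blast
      then show False using S(2) np principal by blast
    qed
    then have n: "1 \<le> CARD('n) - 1" using zero_less_card_finite[where 'a = 'n] by linarith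
    have kD: "k \<le> k * D" for k using D1 by simp
    fix k
    show "depth_quot (ideal_power I k) \<le> enat (CARD('n) - k - 1)" if "1 \<le> k \<and> k \<le> CARD('n) - 1"
    proof -
      have "CARD('n) - 1 - k * D \<le> CARD('n) - k - 1" using kD[of k] by linarith
      then show ?thesis using depth[of k] that by simp
    qed
    have zero: "depth_quot (ideal_power I k) = 0" if "CARD('n) - 1 \<le> k" for k
    proof -
      have "CARD('n) - 1 - k * D = 0" "1 \<le> k" using that n kD[of k] by linarith+
      then show ?thesis using depth[of k] by (simp only: zero_enat_def)
    qed
    then show "depth_quot (ideal_power I k) = 0" if "CARD('n) - 1 \<le> k" using that .
    show "dstab I \<le> CARD('n) - 1" using n zero by (intro dstab_le) auto
    show "max_ideal \<in> Ass (ideal_power I k)" if "CARD('n) - 1 \<le> k"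
      using Ass[of k] that n kD[of k] by linarith
  qed
qed

end
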